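(* Let $\mathbb{K}$ be an algebraically closed field of characteristic zero. Let $G=\Gamma_1\oplus\cdots\oplus\Gamma_s\subset\mathrm{GL}(3,\mathbb{K})$ be a finite abelian non-cyclic group of diagonal matrices of order $d=d_1\cdots d_s$, where each $\Gamma_i$ is cyclic of order $d_i$ and $d_i\mid d_{i+1}$. Then the algebra $\mathrm{A}(X_{2,d}^G)\cong\mathbb{K}[\mathcal{B}_1]$ is Koszul, where $\mathcal{B}_1$ is the set of monomials of degree $d$ in $\mathbb{K}[x_0,x_1,x_2]$ invariant under $G$.
   Context: A diagonal matrix $\operatorname{diag}(g_0,g_1,g_2)$ acts on $\mathbb{K}[x_0,x_1,x_2]$ by $x_i\mapsto g_ix_i$. Each $\Gamma_i$ is generated by a matrix $\operatorname{diag}(e_i^{\alpha_{i0}},e_i^{\alpha_{i1}},e_i^{\alpha_{i2}})$ with $e_i$ a primitive $d_i$-th root of unity and $\gcd(\alpha_{i0},\alpha_{i1},\alpha_{i2},d_i)=1$. $X_{2,d}^G$ is the projective toric variety parameterized by $\mathcal{B}_1=\{m_1,\dots,m_\mu\}$, with homogeneous ideal the kernel of $\mathbb{K}[w_1,\dots,w_\mu]\to\mathbb{K}[x_0,x_1,x_2]$, $w_i\mapsto m_i$, and homogeneous coordinate ring $\mathrm{A}(X_{2,d}^G)\cong\mathbb{K}[\mathcal{B}_1]$, standard graded with each $m_i$ in degree 1. A standard graded $\mathbb{K}$-algebra $A$ is Koszul if $\mathbb{K}=A/A_{>0}$ has a linear minimal graded free resolution over $A$. *)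

theory Defs
  imports
    "HOL-Library.Poly_Mapping"
    "HOL-Computational_Algebra.Polynomial"
    "HOL-Analysis.Cartesian_Space"
    "HOL-Algebra.Elementary_Groups"
    "HOL-Algebra.Generated_Rings"
    "HOL-Algebra.QuotRing"
begin

section \<open>Multivariate polynomials\<close>

text \<open>
  A monomial is an exponent vector \<open>'v \<Rightarrow>\<^sub>0 nat\<close>, and a polynomial a finitely supported
  coefficient function on monomials; the ring operations are those of \<^type>\<open>poly_mapping\<close>.
\<close>

type_synonym ('v, 'k) mpoly = "('v \<Rightarrow>\<^sub>0 nat) \<Rightarrow>\<^sub>0 'k"

definition mConst :: "'k \<Rightarrow> ('v, 'k::comm_ring_1) mpoly" where
  "mConst c = Poly_Mapping.single 0 c"

definition mVar :: "'v \<Rightarrow> ('v, 'k::comm_ring_1) mpoly" where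
  "mVar i = Poly_Mapping.single (Poly_Mapping.single i 1) 1"

definition monom_deg :: "('v \<Rightarrow>\<^sub>0 nat) \<Rightarrow> nat" where
  "monom_deg t = (\<Sum>i\<in>Poly_Mapping.keys t. Poly_Mapping.lookup t i)"

definition homogeneous :: "nat \<Rightarrow> ('v, 'k::comm_ring_1) mpoly \<Rightarrow> bool" where
  "homogeneous n p \<longleftrightarrow> (\<forall>t\<in>Poly_Mapping.keys p. monom_deg t = n)"

text \<open>The \<open>K\<close>-algebra homomorphism sending the \<open>i\<close>-th variable to \<open>f i\<close>.\<close>

definition mpoly_subst ::
    "('v \<Rightarrow> ('w, 'k) mpoly) \<Rightarrow> ('v, 'k::comm_ring_1) mpoly \<Rightarrow> ('w, 'k) mpoly" where
  "mpoly_subst f p =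
     (\<Sum>t\<in>Poly_Mapping.keys p. mConst (Poly_Mapping.lookup p t) *
        (\<Prod>i\<in>Poly_Mapping.keys t. f i ^ Poly_Mapping.lookup t i))"

definition mpoly_ring :: "'v set \<Rightarrow> ('v, 'k::comm_ring_1) mpoly ring" where
  "mpoly_ring V =
     \<lparr>carrier = {p. \<forall>t\<in>Poly_Mapping.keys p. Poly_Mapping.keys t \<subseteq> V},
      mult = (*), one = 1, zero = 0, add = (+)\<rparr>"


section \<open>Graded algebras and Koszul algebras\<close>

definition field_ring :: "'k::field ring" where
  "field_ring = \<lparr>carrier = UNIV, mult = (*), one = 1, zero = 0, add = (+)\<rparr>"

text \<open>The ring \<open>R\<close> with the scalar multiplication given by a structure map \<open>f\<close> into \<open>R\<close>.\<close>

definition scalars_via :: "('c \<Rightarrow> 'a) \<Rightarrow> 'a ring \<Rightarrow> ('c, 'a) module" where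
  "scalars_via f R =
     \<lparr>carrier = carrier R, mult = mult R, one = one R, zero = zero R, add = add R,
      smult = (\<lambda>c x. f c \<otimes>\<^bsub>R\<^esub> x)\<rparr>"

text \<open>
  \<open>gr n\<close> is the component of degree \<open>n\<close>. Standard graded means: \<open>A\<close> is the direct sum of the
  \<open>gr n\<close>, \<open>gr 0 = K\<close>, and \<open>A\<close> is generated over \<open>K\<close> by finitely many elements of degree 1.
\<close>

definition standard_graded ::
    "'k ring \<Rightarrow> ('k, 'a) module \<Rightarrow> (nat \<Rightarrow> 'a set) \<Rightarrow> bool" where
  "standard_graded K A gr \<longleftrightarrow>
     field K \<and> algebra K A \<and> \<one>\<^bsub>A\<^esub> \<noteq> \<zero>\<^bsub>A\<^esub> \<and>
     (\<forall>n. submodule (gr n) K A) \<and>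
     (\<forall>a\<in>carrier A. \<exists>!f. (\<forall>n. f n \<in> gr n) \<and> finite {n. f n \<noteq> \<zero>\<^bsub>A\<^esub>} \<and>
        a = (\<Oplus>\<^bsub>A\<^esub>n\<in>{n. f n \<noteq> \<zero>\<^bsub>A\<^esub>}. f n)) \<and>
     (\<forall>i j. \<forall>a\<in>gr i. \<forall>b\<in>gr j. a \<otimes>\<^bsub>A\<^esub> b \<in> gr (i + j)) \<and>
     gr 0 = (\<lambda>c. c \<odot>\<^bsub>A\<^esub> \<one>\<^bsub>A\<^esub>) ` carrier K \<and>
     (\<exists>S. finite S \<and> S \<subseteq> gr 1 \<and> carrier A = generate_ring A (gr 0 \<union> S))"

definition graded_algebra_iso ::
    "'k ring \<Rightarrow> ('k, 'a) module \<Rightarrow> (nat \<Rightarrow> 'a set) \<Rightarrow>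
     ('k, 'b) module \<Rightarrow> (nat \<Rightarrow> 'b set) \<Rightarrow> ('a \<Rightarrow> 'b) \<Rightarrow> bool" where
  "graded_algebra_iso K A gr B gr' h \<longleftrightarrow>
     h \<in> ring_iso A B \<and>
     (\<forall>c\<in>carrier K. \<forall>a\<in>carrier A. h (c \<odot>\<^bsub>A\<^esub> a) = c \<odot>\<^bsub>B\<^esub> h a) \<and>
     (\<forall>n. h ` gr n = gr' n)"

text \<open>\<open>A\<^sub>>\<^sub>0\<close>, the sum of the components of positive degree.\<close>

definition positive_part ::
    "('a, 'm) ring_scheme \<Rightarrow> (nat \<Rightarrow> 'a set) \<Rightarrow> 'a set" where
  "positive_part A gr = generate (add_monoid A) (\<Union>n\<in>{1..}. gr n)"

text \<open>\<open>A / A\<^sub>>\<^sub>0\<close> as a graded \<open>A\<close>-module, the grading being the image of the grading of \<open>A\<close>.\<close>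

definition residue_module ::
    "('a, 'm) ring_scheme \<Rightarrow> (nat \<Rightarrow> 'a set) \<Rightarrow> ('a, 'a set) module" where
  "residue_module A gr =
     scalars_via (\<lambda>a. positive_part A gr +>\<^bsub>A\<^esub> a) (A Quot positive_part A gr)"

definition residue_grading ::
    "('a, 'm) ring_scheme \<Rightarrow> (nat \<Rightarrow> 'a set) \<Rightarrow> nat \<Rightarrow> 'a set set" where
  "residue_grading A gr n = (\<lambda>a. positive_part A gr +>\<^bsub>A\<^esub> a) ` gr n"

text \<open>
  The free module \<open>A\<^sup>r\<close>. The fields \<open>mult\<close> and \<open>one\<close>, which a module record inherits from the
  record of rings, play no role.
\<close>

definition free_module ::
    "('a, 'm) ring_scheme \<Rightarrow> nat \<Rightarrow> ('a, nat \<Rightarrow> 'a) module" where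
  "free_module A r =
     \<lparr>carrier = {..<r} \<rightarrow>\<^sub>E carrier A, mult = undefined, one = undefined,
      zero = (\<lambda>i\<in>{..<r}. \<zero>\<^bsub>A\<^esub>),
      add = (\<lambda>u v. \<lambda>i\<in>{..<r}. u i \<oplus>\<^bsub>A\<^esub> v i),
      smult = (\<lambda>a v. \<lambda>i\<in>{..<r}. a \<otimes>\<^bsub>A\<^esub> v i)\<rparr>"

text \<open>The degree \<open>n\<close> component of \<open>A(-s 0) \<oplus> \<dots> \<oplus> A(-s (r - 1))\<close>, where \<open>A(-j)\<^sub>n = A\<^bsub>n-j\<^esub>\<close>.\<close>

definition free_grading ::
    "('a, 'm) ring_scheme \<Rightarrow> (nat \<Rightarrow> 'a set) \<Rightarrow> nat \<Rightarrow> (nat \<Rightarrow> nat) \<Rightarrow> nat \<Rightarrow>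
     (nat \<Rightarrow> 'a) set" where
  "free_grading A gr r s n =
     (\<Pi>\<^sub>E j\<in>{..<r}. if s j \<le> n then gr (n - s j) else {\<zero>\<^bsub>A\<^esub>})"

text \<open>Homomorphisms of graded \<open>A\<close>-modules of degree zero.\<close>

definition graded_hom ::
    "('a, 'm) ring_scheme \<Rightarrow> ('a, 'b) module \<Rightarrow> (nat \<Rightarrow> 'b set) \<Rightarrow>
     ('a, 'c) module \<Rightarrow> (nat \<Rightarrow> 'c set) \<Rightarrow> ('b \<Rightarrow> 'c) set" where
  "graded_hom A M grM N grN =
     {f. f \<in> carrier M \<rightarrow> carrier N \<and>
         (\<forall>x\<in>carrier M. \<forall>y\<in>carrier M. f (x \<oplus>\<^bsub>M\<^esub> y) = f x \<oplus>\<^bsub>N\<^esub> f y) \<and>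
         (\<forall>a\<in>carrier A. \<forall>x\<in>carrier M. f (a \<odot>\<^bsub>M\<^esub> x) = a \<odot>\<^bsub>N\<^esub> f x) \<and>
         (\<forall>n. f ` grM n \<subseteq> grN n)}"

text \<open>
  A graded free resolution
  \<open>\<dots> \<rightarrow> F\<^sub>2 \<rightarrow> F\<^sub>1 \<rightarrow> F\<^sub>0 \<rightarrow> M \<rightarrow> 0\<close> with \<open>F\<^sub>i = \<Oplus>\<^bsub>j < r i\<^esub> A(-s i j)\<close>, augmentation
  \<open>\<epsilon> : F\<^sub>0 \<rightarrow> M\<close> and differentials \<open>\<delta> i : F\<^bsub>i+1\<^esub> \<rightarrow> F\<^sub>i\<close>. Ranks are finite, as they are in the
  minimal resolution of a finitely generated graded module over a standard graded algebra.
\<close>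

definition graded_free_resolution ::
    "('a, 'm) ring_scheme \<Rightarrow> (nat \<Rightarrow> 'a set) \<Rightarrow> ('a, 'b) module \<Rightarrow> (nat \<Rightarrow> 'b set) \<Rightarrow>
     (nat \<Rightarrow> nat) \<Rightarrow> (nat \<Rightarrow> nat \<Rightarrow> nat) \<Rightarrow> ((nat \<Rightarrow> 'a) \<Rightarrow> 'b) \<Rightarrow>
     (nat \<Rightarrow> (nat \<Rightarrow> 'a) \<Rightarrow> (nat \<Rightarrow> 'a)) \<Rightarrow> bool" where
  "graded_free_resolution A gr M grM r s \<epsilon> \<delta> \<longleftrightarrow>
     \<epsilon> \<in> graded_hom A (free_module A (r 0)) (free_grading A gr (r 0) (s 0)) M grM \<and>
     (\<forall>i. \<delta> i \<in> graded_hom A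
        (free_module A (r (Suc i))) (free_grading A gr (r (Suc i)) (s (Suc i)))
        (free_module A (r i)) (free_grading A gr (r i) (s i))) \<and>
     \<epsilon> ` carrier (free_module A (r 0)) = carrier M \<and>
     \<delta> 0 ` carrier (free_module A (r 1)) = a_kernel (free_module A (r 0)) M \<epsilon> \<and>
     (\<forall>i. \<delta> (Suc i) ` carrier (free_module A (r (Suc (Suc i)))) =
        a_kernel (free_module A (r (Suc i))) (free_module A (r i)) (\<delta> i))"

text \<open>Minimality: the image of each differential lies in \<open>A\<^sub>>\<^sub>0 F\<^sub>i = (A\<^sub>>\<^sub>0)\<^sup>r\<close>, \<open>r\<close> the rank of \<open>F\<^sub>i\<close>.\<close>

definition minimal_resolution ::
    "('a, 'm) ring_scheme \<Rightarrow> (nat \<Rightarrow> 'a set) \<Rightarrow> (nat \<Rightarrow> nat) \<Rightarrow>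
     (nat \<Rightarrow> (nat \<Rightarrow> 'a) \<Rightarrow> (nat \<Rightarrow> 'a)) \<Rightarrow> bool" where
  "minimal_resolution A gr r \<delta> \<longleftrightarrow>
     (\<forall>i. \<delta> i ` carrier (free_module A (r (Suc i))) \<subseteq> {..<r i} \<rightarrow>\<^sub>E positive_part A gr)"

text \<open>Linearity: \<open>F\<^sub>i\<close> is a direct sum of copies of \<open>A(-i)\<close>.\<close>

definition linear_resolution :: "(nat \<Rightarrow> nat) \<Rightarrow> (nat \<Rightarrow> nat \<Rightarrow> nat) \<Rightarrow> bool" where
  "linear_resolution r s \<longleftrightarrow> (\<forall>i. \<forall>j<r i. s i j = i)"

definition koszul :: "'k ring \<Rightarrow> ('k, 'a) module \<Rightarrow> (nat \<Rightarrow> 'a set) \<Rightarrow> bool" where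
  "koszul K A gr \<longleftrightarrow>
     standard_graded K A gr \<and>
     (\<exists>r s \<epsilon> \<delta>.
        graded_free_resolution A gr (residue_module A gr) (residue_grading A gr) r s \<epsilon> \<delta> \<and>
        minimal_resolution A gr r \<delta> \<and>
        linear_resolution r s)"


section \<open>Groups of diagonal matrices\<close>

definition GL :: "('k::field ^ 'n ^ 'n) monoid" where
  "GL = \<lparr>carrier = {M. invertible M}, mult = (**), one = mat 1\<rparr>"

definition diag_mat :: "('n \<Rightarrow> 'k::field) \<Rightarrow> 'k ^ 'n ^ 'n" where
  "diag_mat g = (\<chi> i j. if i = j then g i else 0)"

definition primitive_root_of_unity :: "nat \<Rightarrow> 'k::field \<Rightarrow> bool" where
  "primitive_root_of_unity n e \<longleftrightarrow> n > 0 \<and> e ^ n = 1 \<and> (\<forall>k. 0 < k \<and> k < n \<longrightarrow> e ^ k \<noteq> 1)"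

text \<open>The abelian subgroup \<open>G\<close> of \<open>M\<close> is the internal direct sum of the subgroups \<open>\<Gamma> i\<close>.\<close>

definition internal_direct_sum ::
    "('a, 'm) monoid_scheme \<Rightarrow> 'i set \<Rightarrow> ('i \<Rightarrow> 'a set) \<Rightarrow> 'a set \<Rightarrow> bool" where
  "internal_direct_sum M I \<Gamma> G \<longleftrightarrow>
     subgroup G M \<and> comm_group (M\<lparr>carrier := G\<rparr>) \<and>
     (\<forall>i\<in>I. subgroup (\<Gamma> i) M) \<and>
     G = generate M (\<Union>i\<in>I. \<Gamma> i) \<and>
     (\<forall>i\<in>I. \<Gamma> i \<inter> generate M (\<Union>j\<in>I - {i}. \<Gamma> j) = {\<one>\<^bsub>M\<^esub>})"


section \<open>The algebra of invariant monomials and the coordinate ring\<close>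

text \<open>The action \<open>x\<^sub>i \<mapsto> g\<^sub>i x\<^sub>i\<close> of the diagonal matrix \<open>M\<close> with entries \<open>g\<^sub>i\<close>.\<close>

definition diag_act :: "'k ^ 'n ^ 'n \<Rightarrow> ('n, 'k::field) mpoly \<Rightarrow> ('n, 'k) mpoly" where
  "diag_act M = mpoly_subst (\<lambda>i. mConst (M $ i $ i) * mVar i)"

definition invariant_monomials ::
    "('k::field ^ 'n ^ 'n) set \<Rightarrow> nat \<Rightarrow> ('n, 'k) mpoly set" where
  "invariant_monomials G d =
     {p. (\<exists>t. p = Poly_Mapping.single t 1 \<and> monom_deg t = d) \<and> (\<forall>M\<in>G. diag_act M p = p)}"

text \<open>\<open>K[B]\<close>, the \<open>K\<close>-subalgebra of the polynomial ring generated by \<open>B\<close>.\<close>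

definition monomial_algebra :: "('v, 'k::field) mpoly set \<Rightarrow> ('k, ('v, 'k) mpoly) module" where
  "monomial_algebra B =
     scalars_via mConst
       ((mpoly_ring UNIV)\<lparr>carrier := generate_ring (mpoly_ring UNIV) (range mConst \<union> B)\<rparr>)"

text \<open>
  The grading of \<open>K[B]\<close>, for \<open>B\<close> a set of monomials of degree \<open>d > 0\<close>, in which the elements
  of \<open>B\<close> have degree 1: the degree of a polynomial in \<open>K[B]\<close> is its usual degree divided by \<open>d\<close>.
\<close>

definition monomial_grading ::
    "('v, 'k::field) mpoly set \<Rightarrow> nat \<Rightarrow> nat \<Rightarrow> ('v, 'k) mpoly set" where
  "monomial_grading B d n = {p \<in> carrier (monomial_algebra B). homogeneous (n * d) p}"

text \<open>
  The ideal of the projective toric variety parametrized by the monomials \<open>m 1, \<dots>, m \<mu>\<close>, that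
  is, the kernel of \<open>K[w\<^sub>1,\<dots>,w\<^sub>\<mu>] \<rightarrow> K[x]\<close>, \<open>w\<^sub>i \<mapsto> m i\<close>.
\<close>

definition toric_ideal :: "nat \<Rightarrow> (nat \<Rightarrow> ('v, 'k::field) mpoly) \<Rightarrow> (nat, 'k) mpoly set" where
  "toric_ideal \<mu> m = a_kernel (mpoly_ring {1..\<mu>}) (mpoly_ring UNIV) (mpoly_subst m)"

definition coordinate_ring ::
    "nat \<Rightarrow> (nat \<Rightarrow> ('v, 'k::field) mpoly) \<Rightarrow> ('k, (nat, 'k) mpoly set) module" where
  "coordinate_ring \<mu> m =
     scalars_via (\<lambda>c. toric_ideal \<mu> m +>\<^bsub>mpoly_ring {1..\<mu>}\<^esub> mConst c)
       (mpoly_ring {1..\<mu>} Quot toric_ideal \<mu> m)"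

definition coordinate_grading ::
    "nat \<Rightarrow> (nat \<Rightarrow> ('v, 'k::field) mpoly) \<Rightarrow> nat \<Rightarrow> (nat, 'k) mpoly set set" where
  "coordinate_grading \<mu> m n =
     (\<lambda>p. toric_ideal \<mu> m +>\<^bsub>mpoly_ring {1..\<mu>}\<^esub> p) `
       {p \<in> carrier (mpoly_ring {1..\<mu>}). homogeneous n p}"

end

theory Submission
  imports Defs
begin

text \<open>
  As \<open>G\<close> is not cyclic, its exponent divides \<open>N = d\<^sub>s\<close> and \<open>d = p N\<close> with \<open>p \<ge> 2\<close>. Hence all
  monomials with exponents divisible by \<open>N\<close> are invariant: the lattice triangle spanned by the
  \<open>x\<^sub>i\<^sup>d\<close> contains the lattice points of the \<open>p\<close>-fold multiple of a unimodular triangle.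
  Rounding exponents down to multiples of \<open>N\<close>, a pigeonhole argument shows that every invariant
  monomial of degree at least \<open>2d\<close> is divisible by one of these points, even by one with some
  exponent \<open>\<ge> N c\<^sub>i\<close>, whenever \<open>c\<^sub>i \<le> p\<close> and \<open>c\<^sub>0 + c\<^sub>1 + c\<^sub>2 \<le> 2p\<close>.
  Consequently the monomial ideals \<open>0\<close>, \<open>(x\<^sub>0\<^sup>d)\<close>, \<open>(x\<^sub>0\<^sup>d, x\<^sub>1\<^sup>d)\<close>, together with all proper monomial
  ideals that contain the points with some exponent \<open>\<ge> N c\<^sub>i\<close> for such a \<open>c\<close>, form a Koszul
  filtration: each is generated by a sequence of monomials of degree \<open>d\<close> whose successive colon
  ideals are again in the family.

  A Koszul filtration yields the linear resolution by elimination. If all leading ideals of a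
  graded submodule of \<open>A\<^sup>r\<close> (with respect to the last nonzero coordinate) are in the family, then
  the submodule is generated by elements of degree one, and the leading ideals of their syzygy
  module are the successive colon ideals, so the argument can be iterated.
\<close>

section \<open>Linear resolutions from Koszul families of ideals\<close>

text \<open>\<open>C\<close> is meant as a graded algebra inside a larger commutative ring,
  \<open>G\<close> as its component of degree one, and \<open>\<pi>\<^sub>1\<close>,
  \<open>\<pi>\<^sub>2\<close> as the projections to degrees one and two. Elimination uses no more
  of the grading than this: the degree two part of a product with a linear form sees only the linear
  part of the other factor.\<close>

locale degree_one_data =
  fixes C G :: "'a::comm_ring_1 set" and \<pi>\<^sub>1 \<pi>\<^sub>2 :: "'a \<Rightarrow> 'a"
  assumes C_one: "1 \<in> C"
    and C_add: "a \<in> C \<Longrightarrow> b \<in> C \<Longrightarrow> a + b \<in> C"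
    and C_uminus: "a \<in> C \<Longrightarrow> - a \<in> C"
    and C_mult: "a \<in> C \<Longrightarrow> b \<in> C \<Longrightarrow> a * b \<in> C"
    and G_subset: "G \<subseteq> C"
    and proj1_in: "a \<in> C \<Longrightarrow> \<pi>\<^sub>1 a \<in> G"
    and proj1_id: "a \<in> G \<Longrightarrow> \<pi>\<^sub>1 a = a"
    and proj1_add: "\<pi>\<^sub>1 (a + b) = \<pi>\<^sub>1 a + \<pi>\<^sub>1 b"
    and proj2_add: "\<pi>\<^sub>2 (a + b) = \<pi>\<^sub>2 a + \<pi>\<^sub>2 b"
    and proj2_mult: "a \<in> C \<Longrightarrow> b \<in> G \<Longrightarrow> \<pi>\<^sub>2 (a * b) = \<pi>\<^sub>1 a * b"
begin

lemma C_zero: "0 \<in> C"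
  using C_add[OF C_one C_uminus[OF C_one]] by simp

lemma proj1_zero: "\<pi>\<^sub>1 0 = 0"
  using proj1_add[of 0 0] by simp

lemma proj2_zero: "\<pi>\<^sub>2 0 = 0"
  using proj2_add[of 0 0] by simp

lemma proj2_sum: "\<pi>\<^sub>2 (sum f A) = (\<Sum>k\<in>A. \<pi>\<^sub>2 (f k))"
  by (induction A rule: infinite_finite_induct) (auto simp: proj2_zero proj2_add)

section \<open>Spans, syzygies and leading ideals\<close>

definition ideal_span :: "nat \<Rightarrow> (nat \<Rightarrow> 'a) \<Rightarrow> 'a set" where
  "ideal_span q b = {\<Sum>k<q. c k * b k | c. \<forall>k<q. c k \<in> C}"

definition vspan :: "nat \<Rightarrow> (nat \<Rightarrow> nat \<Rightarrow> 'a) \<Rightarrow> (nat \<Rightarrow> 'a) set" where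
  "vspan q g = {\<lambda>j. \<Sum>k<q. c k * g k j | c. \<forall>k<q. c k \<in> C}"

text \<open>Coordinates from \<open>q\<close> on are fixed to 0, so that each relation has exactly
  one representative among the functions on all of \<open>nat\<close>.\<close>

definition syzygies :: "nat \<Rightarrow> (nat \<Rightarrow> nat \<Rightarrow> 'a) \<Rightarrow> (nat \<Rightarrow> 'a) set" where
  "syzygies q g = {c. (\<forall>k. c k \<in> C) \<and> (\<forall>k\<ge>q. c k = 0) \<and> (\<forall>j. (\<Sum>k<q. c k * g k j) = 0)}"

text \<open>A variant of the Koszul filtrations of Conca, Trung and Valla: the successive colon
  ideals have to belong to the family, whereas the ideals generated by initial segments of
  \<open>b\<close> may lie outside it.\<close>

definition koszul_family :: "'a set set \<Rightarrow> bool" where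
  "koszul_family F \<longleftrightarrow> (\<forall>I\<in>F. \<exists>q b. (\<forall>k<q. b k \<in> G) \<and> I = ideal_span q b \<and>
     (\<forall>k<q. {a \<in> C. a * b k \<in> ideal_span k b} \<in> F))"

text \<open>The leading term of a vector is its last nonzero coordinate. Allowing
  \<open>v j = 0\<close> makes this set an ideal when \<open>N\<close> is a submodule.\<close>

definition leading_ideal :: "(nat \<Rightarrow> 'a) set \<Rightarrow> nat \<Rightarrow> 'a set" where
  "leading_ideal N j = {v j | v. v \<in> N \<and> (\<forall>k>j. v k = 0)}"

text \<open>The invariant of the iteration. Closure under \<open>\<pi>\<^sub>1\<close> in each
  coordinate takes the place of homogeneity of the submodule.\<close>

definition filtered_by :: "'a set set \<Rightarrow> nat \<Rightarrow> (nat \<Rightarrow> 'a) set \<Rightarrow> bool" where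
  "filtered_by F r N \<longleftrightarrow>
     (\<forall>v\<in>N. (\<forall>k. v k \<in> C) \<and> (\<forall>k\<ge>r. v k = 0)) \<and>
     (\<lambda>k. 0) \<in> N \<and>
     (\<forall>v\<in>N. \<forall>w\<in>N. (\<lambda>k. v k + w k) \<in> N) \<and>
     (\<forall>a\<in>C. \<forall>v\<in>N. (\<lambda>k. a * v k) \<in> N) \<and>
     (\<forall>v\<in>N. (\<lambda>k. \<pi>\<^sub>1 (v k)) \<in> N) \<and>
     (\<forall>j<r. leading_ideal N j \<in> F)"

section \<open>Elimination by the last nonzero coordinate\<close>

lemma filtered_by_sum:
  assumes "filtered_by F r N" "\<And>k. k < (q::nat) \<Longrightarrow> g k \<in> N" "\<And>k. k < q \<Longrightarrow> c k \<in> C"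
  shows "(\<lambda>j. \<Sum>k<q. c k * g k j) \<in> N"
  using assms(2,3)
proof (induction q)
  case 0
  then show ?case using assms(1) by (simp add: filtered_by_def)
next
  case (Suc q)
  then have 1: "(\<lambda>j. \<Sum>k<q. c k * g k j) \<in> N" by simp
  have 2: "(\<lambda>j. c q * g q j) \<in> N" using Suc.prems assms(1) by (simp add: filtered_by_def)
  have add: "\<forall>v\<in>N. \<forall>w\<in>N. (\<lambda>k. v k + w k) \<in> N" using assms(1) by (simp add: filtered_by_def)
  show ?case using bspec[OF bspec[OF add 1] 2] by simp
qed

lemma vspan_cong: "(\<And>k. k < q \<Longrightarrow> g k = h k) \<Longrightarrow> vspan q g = vspan q h"
proof -
  assume "\<And>k. k < q \<Longrightarrow> g k = h k"
  then have "(\<Sum>k<q. c k * g k j) = (\<Sum>k<q. c k * h k j)" for c j by (intro sum.cong) auto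
  then show ?thesis by (simp add: vspan_def)
qed

text \<open>Induction on the number of coordinates that may be nonzero. Generators of the leading
  ideal in the new coordinate are lifted to \<open>N\<close> and appended to the old generators; the
  old colon ideals do not change, and the new ones are those of the leading ideal.\<close>

lemma filtered_generators:
  assumes F: "koszul_family F" and N: "filtered_by F r N" and "j \<le> r"
  shows "\<exists>q g. (\<forall>k<q. g k \<in> N \<and> (\<forall>i. g k i \<in> G)) \<and> vspan q g = {v \<in> N. \<forall>k\<ge>j. v k = 0} \<and>
    (\<forall>k<q. {a \<in> C. (\<lambda>i. a * g k i) \<in> vspan k g} \<in> F)"
  using \<open>j \<le> r\<close>
proof (induction j)
  case 0
  have "vspan 0 (\<lambda>_ _. 0) = {v \<in> N. \<forall>k\<ge>0. v k = 0}"
  proof -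
    have "v = (\<lambda>_. 0)" if "\<forall>k\<ge>0. v k = 0" for v :: "nat \<Rightarrow> 'a" using that by auto
    moreover have "(\<lambda>_. 0) \<in> N" using N by (simp add: filtered_by_def)
    ultimately show ?thesis by (auto simp: vspan_def)
  qed
  then show ?case by (intro exI[of _ 0] exI[of _ "\<lambda>_ _. 0"]) auto
next
  case (Suc j)
  have NC: "\<And>v k. v \<in> N \<Longrightarrow> v k \<in> C" and Nadd: "\<And>v w. v \<in> N \<Longrightarrow> w \<in> N \<Longrightarrow> (\<lambda>k. v k + w k) \<in> N"
    and Nmul: "\<And>a v. a \<in> C \<Longrightarrow> v \<in> N \<Longrightarrow> (\<lambda>k. a * v k) \<in> N"
    and Nproj: "\<And>v. v \<in> N \<Longrightarrow> (\<lambda>k. \<pi>\<^sub>1 (v k)) \<in> N"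
    and Nlead: "leading_ideal N j \<in> F"
    using N Suc.prems by (auto simp: filtered_by_def)
  obtain q g where g: "\<And>k. k < q \<Longrightarrow> g k \<in> N" "\<And>k i. k < q \<Longrightarrow> g k i \<in> G"
    and span: "vspan q g = {v \<in> N. \<forall>k\<ge>j. v k = 0}"
    and col: "\<And>k. k < q \<Longrightarrow> {a \<in> C. (\<lambda>i. a * g k i) \<in> vspan k g} \<in> F"
    using Suc.IH[OF Suc_leD[OF Suc.prems]] by auto
  obtain p b where b: "\<And>k. k < p \<Longrightarrow> b k \<in> G" and lead: "leading_ideal N j = ideal_span p b"
    and bcol: "\<And>k. k < p \<Longrightarrow> {a \<in> C. a * b k \<in> ideal_span k b} \<in> F"
    using F Nlead unfolding koszul_family_def by metis
  \<comment> \<open>Some vector of \<open>N\<close> has leading coefficient \<open>b k\<close>. Its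
    degree one part stays in \<open>N\<close>, has entries in \<open>G\<close> and keeps
    \<open>b k\<close>, which \<open>\<pi>\<^sub>1\<close> fixes.\<close>
  have "\<exists>h. h \<in> N \<and> (\<forall>i. h i \<in> G) \<and> h j = b k \<and> (\<forall>i>j. h i = 0)" if "k < p" for k
  proof -
    have "b k = (\<Sum>l<p. (if l = k then 1 else 0) * b l)"
      using that by (simp add: if_distrib[of "\<lambda>x. x * _"] cong: if_cong)
    then have "b k \<in> leading_ideal N j"
      unfolding lead ideal_span_def using C_zero C_one
      by (intro CollectI exI[of _ "\<lambda>l. if l = k then 1 else 0"]) auto
    then obtain v where v: "v \<in> N" "v j = b k" "\<forall>i>j. v i = 0"
      by (auto simp: leading_ideal_def)
    then show ?thesis
      using Nproj[OF v(1)] NC proj1_in proj1_id b[OF that] proj1_zero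
      by (intro exI[of _ "\<lambda>i. \<pi>\<^sub>1 (v i)"]) auto
  qed
  then obtain h where h: "\<And>k. k < p \<Longrightarrow> h k \<in> N" "\<And>k i. k < p \<Longrightarrow> h k i \<in> G"
    "\<And>k. k < p \<Longrightarrow> h k j = b k" "\<And>k i. k < p \<Longrightarrow> i > j \<Longrightarrow> h k i = 0"
    by metis
  define g' where "g' k = (if k < q then g k else h (k - q))" for k
  have split: "(\<Sum>k<q+n. c k * g' k i) = (\<Sum>k<q. c k * g k i) + (\<Sum>k<n. c (q + k) * h k i)" for c n i
    by (induction n) (auto simp: g'_def add.assoc)
  have g'N: "g' k \<in> N" "g' k i \<in> G" if "k < q + p" for k i
    using that g h by (auto simp: g'_def)
  have g0: "g k i = 0" if "k < q" "i \<ge> j" for k i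
  proof -
    have "(\<lambda>i. \<Sum>l<q. (if l = k then 1 else 0) * g l i) \<in> vspan q g"
      unfolding vspan_def using C_zero C_one
      by (intro CollectI exI[of _ "\<lambda>l. if l = k then 1 else 0"]) auto
    moreover have "(\<lambda>i. \<Sum>l<q. (if l = k then 1 else 0) * g l i) = g k"
      using that by (simp add: if_distrib[of "\<lambda>x. x * _"] cong: if_cong)
    ultimately show ?thesis using span that by auto
  qed
  \<comment> \<open>Since the old generators span everything that vanishes from \<open>j\<close> on,
    membership in the span of an initial segment is decided by coordinate \<open>j\<close>
    alone.\<close>
  have key: "v \<in> vspan (q + n) g' \<longleftrightarrow> v \<in> N \<and> (\<forall>i>j. v i = 0) \<and> v j \<in> ideal_span n b"
    if "n \<le> p" for n v
  proof
    assume "v \<in> vspan (q + n) g'"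
    then obtain c where c: "\<forall>k<q+n. c k \<in> C" "v = (\<lambda>i. \<Sum>k<q+n. c k * g' k i)"
      by (auto simp: vspan_def)
    have "v \<in> N" unfolding c(2) using c(1) g'N(1) \<open>n \<le> p\<close> by (intro filtered_by_sum[OF N]) auto
    moreover have "\<forall>i>j. v i = 0"
      using \<open>n \<le> p\<close> by (auto simp: c(2) split g0 h(4))
    moreover have "v j = (\<Sum>k<n. c (q + k) * b k)"
      using \<open>n \<le> p\<close> by (simp add: c(2) split g0 h(3))
    then have "v j \<in> ideal_span n b"
      unfolding ideal_span_def using c(1) by (auto intro!: exI[of _ "\<lambda>k. c (q + k)"])
    ultimately show "v \<in> N \<and> (\<forall>i>j. v i = 0) \<and> v j \<in> ideal_span n b" by blast
  next
    assume v: "v \<in> N \<and> (\<forall>i>j. v i = 0) \<and> v j \<in> ideal_span n b"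
    then obtain c where c: "\<forall>k<n. c k \<in> C" "v j = (\<Sum>k<n. c k * b k)"
      by (auto simp: ideal_span_def)
    \<comment> \<open>Subtracting the lifts cancels coordinate \<open>j\<close>, so the remainder
      falls into the span of the old generators.\<close>
    define w where "w = (\<lambda>i. v i + (-1) * (\<Sum>k<n. c k * h k i))"
    have "(\<lambda>i. \<Sum>k<n. c k * h k i) \<in> N"
      using c(1) h(1) \<open>n \<le> p\<close> by (intro filtered_by_sum[OF N]) auto
    then have "w \<in> N" unfolding w_def
      using Nadd[OF _ Nmul[OF C_uminus[OF C_one]]] v by blast
    moreover have "w i = 0" if "i \<ge> j" for i
    proof (cases "i = j")
      case True
      then show ?thesis using \<open>n \<le> p\<close> by (simp add: w_def c(2) h(3))
    next
      case False
      then show ?thesis using \<open>n \<le> p\<close> v that by (simp add: w_def h(4))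
    qed
    ultimately have "w \<in> vspan q g" using span by auto
    then obtain e where e: "\<forall>k<q. e k \<in> C" "w = (\<lambda>i. \<Sum>k<q. e k * g k i)"
      by (auto simp: vspan_def)
    define f where "f k = (if k < q then e k else c (k - q))" for k
    have "v i = (\<Sum>k<q+n. f k * g' k i)" for i
    proof -
      have "v i = w i + (\<Sum>k<n. c k * h k i)" by (simp add: w_def)
      then show ?thesis unfolding split by (simp add: f_def e(2))
    qed
    moreover have "\<forall>k<q+n. f k \<in> C" using e(1) c(1) by (auto simp: f_def)
    ultimately show "v \<in> vspan (q + n) g'" unfolding vspan_def by blast
  qed
  have "vspan (q + p) g' = {v \<in> N. \<forall>k\<ge>Suc j. v k = 0}"
  proof -
    have "v j \<in> ideal_span p b" if "v \<in> N" "\<forall>k>j. v k = 0" for v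
      unfolding lead[symmetric] leading_ideal_def using that by auto
    then show ?thesis by (auto simp: key Suc_le_eq)
  qed
  moreover have "{a \<in> C. (\<lambda>i. a * g' k i) \<in> vspan k g'} \<in> F" if "k < q + p" for k
  proof (cases "k < q")
    case True
    then have "vspan k g' = vspan k g" by (intro vspan_cong) (auto simp: g'_def)
    then show ?thesis using col[OF True] True by (simp add: g'_def)
  next
    case False
    define n where "n = k - q"
    have n: "k = q + n" "n < p" using False that by (auto simp: n_def)
    \<comment> \<open>Multiples of \<open>h n\<close> are in \<open>N\<close> and vanish above
      \<open>j\<close>, so by \<open>key\<close> only the condition on coordinate \<open>j\<close>
      remains.\<close>
    have "{a \<in> C. (\<lambda>i. a * g' k i) \<in> vspan k g'} = {a \<in> C. a * b n \<in> ideal_span n b}"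
      using n h Nmul by (auto simp: key g'_def)
    then show ?thesis using bcol[OF n(2)] by simp
  qed
  ultimately show ?case using g'N by (intro exI[of _ "q + p"] exI[of _ g']) auto
qed

text \<open>The leading ideals of the syzygies of \<open>g\<close> are the colon ideals \<open>(g\<^sub>0,\<dots>,g\<^bsub>k-1\<^esub>) : g\<^sub>k\<close>.\<close>

lemma filtered_step:
  assumes F: "koszul_family F" and N: "filtered_by F r N"
  shows "\<exists>q g. (\<forall>k<q. \<forall>i. g k i \<in> G) \<and> (\<forall>k<q. \<forall>i\<ge>r. g k i = 0) \<and> N = vspan q g \<and>
    filtered_by F q (syzygies q g)"
proof -
  obtain q g where g: "\<And>k. k < q \<Longrightarrow> g k \<in> N" "\<And>k i. k < q \<Longrightarrow> g k i \<in> G"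
    and span: "vspan q g = {v \<in> N. \<forall>k\<ge>r. v k = 0}"
    and col: "\<And>k. k < q \<Longrightarrow> {a \<in> C. (\<lambda>i. a * g k i) \<in> vspan k g} \<in> F"
    using filtered_generators[OF F N order_refl] by auto
  have N0: "v k = 0" if "v \<in> N" "k \<ge> r" for v k using N that by (auto simp: filtered_by_def)
  have "{v \<in> N. \<forall>k\<ge>r. v k = 0} = N" using N0 by auto
  moreover have "filtered_by F q (syzygies q g)"
    unfolding filtered_by_def
  proof (intro conjI ballI allI impI)
    show "(\<lambda>k. 0) \<in> syzygies q g" by (simp add: syzygies_def C_zero)
  next
    fix v w assume "v \<in> syzygies q g" "w \<in> syzygies q g"
    then show "(\<lambda>k. v k + w k) \<in> syzygies q g"
      by (auto simp: syzygies_def C_add distrib_right sum.distrib)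
  next
    fix a v assume "a \<in> C" "v \<in> syzygies q g"
    then show "(\<lambda>k. a * v k) \<in> syzygies q g"
      by (auto simp: syzygies_def C_mult mult.assoc sum_distrib_left[symmetric])
  next
    fix v assume v: "v \<in> syzygies q g"
    \<comment> \<open>The entries of \<open>g\<close> have degree one, so the degree two part of the
      relation is the relation for the degree one parts of its coefficients.\<close>
    have "(\<Sum>k<q. \<pi>\<^sub>1 (v k) * g k j) = \<pi>\<^sub>2 (\<Sum>k<q. v k * g k j)" for j
      unfolding proj2_sum using v g(2) by (intro sum.cong) (auto simp: proj2_mult syzygies_def)
    then show "(\<lambda>k. \<pi>\<^sub>1 (v k)) \<in> syzygies q g"
      using v proj1_in G_subset by (auto simp: syzygies_def proj1_zero proj2_zero)
  next
    fix k assume k: "k < q"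
    have "leading_ideal (syzygies q g) k = {a \<in> C. (\<lambda>i. a * g k i) \<in> vspan k g}"
    proof (intro equalityI subsetI)
      fix a assume "a \<in> leading_ideal (syzygies q g) k"
      then obtain v where v: "v \<in> syzygies q g" "a = v k" "\<forall>l>k. v l = 0"
        by (auto simp: leading_ideal_def)
      have "v k * g k i = (\<Sum>l<k. - v l * g l i)" for i
      proof -
        have "0 = (\<Sum>l<q. v l * g l i)" using v by (simp add: syzygies_def)
        also have "\<dots> = (\<Sum>l<Suc k. v l * g l i)"
          using k v(3) by (intro sum.mono_neutral_right) auto
        finally have "(\<Sum>l<k. v l * g l i) + v k * g k i = 0" by simp
        then show ?thesis by (simp add: sum_negf eq_neg_iff_add_eq_0 add.commute)
      qed
      moreover have "\<forall>l<k. - v l \<in> C" using v by (auto simp: syzygies_def C_uminus)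
      ultimately show "a \<in> {a \<in> C. (\<lambda>i. a * g k i) \<in> vspan k g}"
        using v by (auto simp: vspan_def syzygies_def intro!: exI[of _ "\<lambda>l. - v l"])
    next
      fix a assume a: "a \<in> {a \<in> C. (\<lambda>i. a * g k i) \<in> vspan k g}"
      then obtain c where "\<forall>l<k. c l \<in> C" and "(\<lambda>i. a * g k i) = (\<lambda>i. \<Sum>l<k. c l * g l i)"
        by (auto simp: vspan_def)
      then have c: "\<forall>l<k. c l \<in> C" "\<And>i. a * g k i = (\<Sum>l<k. c l * g l i)" by metis+
      \<comment> \<open>Moving the expression of \<open>a * g k\<close> in the earlier generators to
        the other side gives a syzygy with last coordinate \<open>a\<close>.\<close>
      define v where "v l = (if l < k then - c l else if l = k then a else 0)" for l
      have "(\<Sum>l<q. v l * g l i) = 0" for i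
      proof -
        have "(\<Sum>l<q. v l * g l i) = (\<Sum>l<Suc k. v l * g l i)"
          using k by (intro sum.mono_neutral_right) (auto simp: v_def)
        also have "\<dots> = (\<Sum>l<k. - c l * g l i) + a * g k i" by (simp add: v_def)
        finally show ?thesis by (simp add: c(2) sum_negf)
      qed
      then have "v \<in> syzygies q g"
        using a c(1) k by (auto simp: syzygies_def v_def C_uminus C_zero)
      then show "a \<in> leading_ideal (syzygies q g) k"
        unfolding leading_ideal_def by (auto simp: v_def intro!: exI[of _ v])
    qed
    then show "leading_ideal (syzygies q g) k \<in> F" using col[OF k] by simp
  qed (auto simp: syzygies_def)
  ultimately show ?thesis using g N0 span by (intro exI[of _ q] exI[of _ g]) auto
qed

text \<open>Iterates \<open>filtered_step\<close>, starting from \<open>m\<close> as a submodule of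
  the free module of rank one. The vector \<open>g i k\<close> is the image in free module number
  \<open>i\<close> of the \<open>k\<close>-th basis vector of the next one; the last two clauses are
  exactness in coordinates. Entries in \<open>G\<close> will give both linearity and
  minimality.\<close>

lemma linear_resolution_exists:
  assumes F: "koszul_family F" and m: "m \<in> F"
    and "m \<subseteq> C" "0 \<in> m" "\<And>a b. a \<in> m \<Longrightarrow> b \<in> m \<Longrightarrow> a + b \<in> m"
    "\<And>a b. a \<in> C \<Longrightarrow> b \<in> m \<Longrightarrow> a * b \<in> m" "\<And>a. a \<in> m \<Longrightarrow> \<pi>\<^sub>1 a \<in> m"
  shows "\<exists>(r :: nat \<Rightarrow> nat) g. r 0 = 1 \<and> (\<forall>i. \<forall>k<r (Suc i). \<forall>j. g i k j \<in> G) \<and>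
    (\<forall>a. a \<in> m \<longleftrightarrow> (\<exists>c. (\<forall>k<r 1. c k \<in> C) \<and> a = (\<Sum>k<r 1. c k * g 0 k 0))) \<and>
    (\<forall>i c. (\<forall>k<r (Suc i). c k \<in> C) \<longrightarrow>
      ((\<forall>j<r i. (\<Sum>k<r (Suc i). c k * g i k j) = 0) \<longleftrightarrow>
       (\<exists>c'. (\<forall>l<r (Suc (Suc i)). c' l \<in> C) \<and>
          (\<forall>k<r (Suc i). c k = (\<Sum>l<r (Suc (Suc i)). c' l * g (Suc i) l k)))))"
proof -
  define N0 where "N0 = {v. v 0 \<in> m \<and> (\<forall>k\<ge>1::nat. v k = 0)}"
  have "leading_ideal N0 0 = m"
  proof (intro equalityI subsetI)
    fix a assume "a \<in> m"
    then show "a \<in> leading_ideal N0 0"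
      by (auto simp: leading_ideal_def N0_def intro!: exI[of _ "\<lambda>k. if k = 0 then a else 0"])
  qed (auto simp: leading_ideal_def N0_def)
  then have N0: "filtered_by F 1 N0"
  proof -
    have "v k \<in> C" if "v 0 \<in> m" "\<forall>k\<ge>1. v k = 0" for v :: "nat \<Rightarrow> 'a" and k
      using that assms(3) C_zero by (cases k) auto
    moreover have "leading_ideal N0 j \<in> F" if "j < 1" for j
      using that m \<open>leading_ideal N0 0 = m\<close> by simp
    ultimately show ?thesis
      using assms(4-7) unfolding filtered_by_def by (simp add: N0_def proj1_zero)
  qed
  define step where "step r g q g' \<longleftrightarrow> (\<forall>k<q. \<forall>i. g' k i \<in> G) \<and> (\<forall>k<q. \<forall>i\<ge>r. g' k i = 0) \<and>
     syzygies r g = vspan q g' \<and> filtered_by F q (syzygies q g')" for r g and q :: nat and g'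
  obtain q0 g0 where g0: "\<forall>k<q0. \<forall>i. g0 k i \<in> G" "\<forall>k<q0. \<forall>i\<ge>1. g0 k i = 0" "N0 = vspan q0 g0"
    "filtered_by F q0 (syzygies q0 g0)"
    using filtered_step[OF F N0] by auto
  \<comment> \<open>Dependent choice on pairs of a rank and a family of generators. The invariant,
    that the syzygies are filtered, permits the next step.\<close>
  have "\<exists>f. \<forall>n. ((\<lambda>(q, g). filtered_by F q (syzygies q g)) (f n) \<and> (n = 0 \<longrightarrow> f n = (q0, g0))) \<and>
        (\<lambda>(r, g) (q, g'). step r g q g') (f n) (f (Suc n))"
  proof (rule dependent_nat_choice, goal_cases)
    case 1
    then show ?case using g0 by auto
  next
    case (2 x n)
    obtain r g where x: "x = (r, g)" by force
    with 2 have "filtered_by F r (syzygies r g)" by simp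
    from filtered_step[OF F this] show ?case
      by (auto simp: x step_def)
  qed
  then obtain f where f: "\<forall>n. ((\<lambda>(q, g). filtered_by F q (syzygies q g)) (f n) \<and> (n = 0 \<longrightarrow> f n = (q0, g0))) \<and>
        (\<lambda>(r, g) (q, g'). step r g q g') (f n) (f (Suc n))" ..
  have f0: "f 0 = (q0, g0)" using spec[OF f, of 0] by simp
  \<comment> \<open>Index shift: \<open>f i\<close> describes the map into module number
    \<open>i\<close>, so its rank \<open>fst (f i)\<close> belongs to module number
    \<open>i + 1\<close>; module number 0 has rank 1.\<close>
  define r where "r i = (case i of 0 \<Rightarrow> 1 | Suc i \<Rightarrow> fst (f i))" for i
  define g where "g i = snd (f i)" for i
  have st: "step (r (Suc i)) (g i) (r (Suc (Suc i))) (g (Suc i))" for i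
    using spec[OF f, of i] by (simp add: r_def g_def case_prod_beta)
  have [simp]: "r 0 = 1" "r (Suc 0) = q0" "g 0 = g0" by (auto simp: r_def g_def f0)
  have gG: "\<forall>k<r (Suc i). \<forall>j. g i k j \<in> G" for i
    using st[of "i - 1"] g0(1) by (cases i) (simp_all add: step_def)
  \<comment> \<open>As entries beyond the rank vanish, a relation in the coordinates
    \<open>j < r i\<close> holds in all coordinates, which \<open>syzygies\<close> demands.\<close>
  have gz: "\<forall>k<r (Suc i). \<forall>j\<ge>r i. g i k j = 0" for i
    using st[of "i - 1"] g0(2) by (cases i) (simp_all add: step_def)
  have m_iff: "a \<in> m \<longleftrightarrow> (\<exists>c. (\<forall>k<r 1. c k \<in> C) \<and> a = (\<Sum>k<r 1. c k * g 0 k 0))" for a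
  proof
    assume "a \<in> m"
    then have "(\<lambda>k. if k = 0 then a else 0) \<in> vspan q0 g0"
      unfolding g0(3)[symmetric] by (simp add: N0_def)
    then obtain c where "(\<lambda>k. if k = 0 then a else 0) = (\<lambda>j. \<Sum>k<q0. c k * g0 k j)" "\<forall>k<q0. c k \<in> C"
      by (auto simp: vspan_def)
    then show "\<exists>c. (\<forall>k<r 1. c k \<in> C) \<and> a = (\<Sum>k<r 1. c k * g 0 k 0)"
      by (intro exI[of _ c]) (auto dest: fun_cong[of _ _ 0])
  next
    assume "\<exists>c. (\<forall>k<r 1. c k \<in> C) \<and> a = (\<Sum>k<r 1. c k * g 0 k 0)"
    then obtain c where c: "\<forall>k<q0. c k \<in> C" "a = (\<Sum>k<q0. c k * g0 k 0)" by auto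
    then have "(\<lambda>j. \<Sum>k<q0. c k * g0 k j) \<in> N0" unfolding g0(3) vspan_def by blast
    then show "a \<in> m" by (simp add: N0_def c(2))
  qed
  have ex: "(\<forall>j<r i. (\<Sum>k<r (Suc i). c k * g i k j) = 0) \<longleftrightarrow>
       (\<exists>c'. (\<forall>l<r (Suc (Suc i)). c' l \<in> C) \<and>
          (\<forall>k<r (Suc i). c k = (\<Sum>l<r (Suc (Suc i)). c' l * g (Suc i) l k)))"
    if c: "\<forall>k<r (Suc i). c k \<in> C" for i c
  proof
    assume *: "\<forall>j<r i. (\<Sum>k<r (Suc i). c k * g i k j) = 0"
    define v where "v k = (if k < r (Suc i) then c k else 0)" for k
    have "(\<Sum>k<r (Suc i). v k * g i k j) = 0" for j
    proof (cases "j < r i")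
      case False
      then show ?thesis using gz[of i] by simp
    qed (use * in \<open>simp add: v_def\<close>)
    then have "v \<in> vspan (r (Suc (Suc i))) (g (Suc i))"
      using st[of i] c by (auto simp: step_def syzygies_def v_def C_zero)
    then obtain c' where "\<forall>l<r (Suc (Suc i)). c' l \<in> C"
      and v: "v = (\<lambda>k. \<Sum>l<r (Suc (Suc i)). c' l * g (Suc i) l k)" by (auto simp: vspan_def)
    moreover have "c k = (\<Sum>l<r (Suc (Suc i)). c' l * g (Suc i) l k)" if "k < r (Suc i)" for k
      using that fun_cong[OF v, of k] by (simp add: v_def)
    ultimately show "\<exists>c'. (\<forall>l<r (Suc (Suc i)). c' l \<in> C) \<and>
          (\<forall>k<r (Suc i). c k = (\<Sum>l<r (Suc (Suc i)). c' l * g (Suc i) l k))"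
      by (intro exI[of _ c']) simp
  next
    assume "\<exists>c'. (\<forall>l<r (Suc (Suc i)). c' l \<in> C) \<and>
          (\<forall>k<r (Suc i). c k = (\<Sum>l<r (Suc (Suc i)). c' l * g (Suc i) l k))"
    then obtain c' where c': "\<forall>l<r (Suc (Suc i)). c' l \<in> C"
      "\<forall>k<r (Suc i). c k = (\<Sum>l<r (Suc (Suc i)). c' l * g (Suc i) l k)" by blast
    then have "(\<lambda>k. \<Sum>l<r (Suc (Suc i)). c' l * g (Suc i) l k) \<in> syzygies (r (Suc i)) (g i)"
      using st[of i] unfolding step_def vspan_def by blast
    then have s: "(\<Sum>k<r (Suc i). (\<Sum>l<r (Suc (Suc i)). c' l * g (Suc i) l k) * g i k j) = 0" for j
      by (simp add: syzygies_def)
    show "\<forall>j<r i. (\<Sum>k<r (Suc i). c k * g i k j) = 0"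
    proof (intro allI impI)
      fix j
      have "(\<Sum>k<r (Suc i). c k * g i k j)
          = (\<Sum>k<r (Suc i). (\<Sum>l<r (Suc (Suc i)). c' l * g (Suc i) l k) * g i k j)"
        using c'(2) by (intro sum.cong) auto
      then show "(\<Sum>k<r (Suc i). c k * g i k j) = 0" using s by simp
    qed
  qed
  have "\<forall>i. \<forall>k<r (Suc i). \<forall>j. g i k j \<in> G" using gG by blast
  then show ?thesis
    using m_iff ex \<open>r 0 = 1\<close> by (intro exI[of _ r] exI[of _ g]) simp
qed

end

section \<open>Monomial ideals of a monoid algebra\<close>

abbreviation (input) keys where "keys \<equiv> Poly_Mapping.keys"
abbreviation (input) lookup where "lookup \<equiv> Poly_Mapping.lookup"
abbreviation (input) single where "single \<equiv> Poly_Mapping.single"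

section \<open>Degrees and supports of polynomials\<close>

lemma monom_deg_add: "monom_deg (s + t) = monom_deg s + monom_deg t"
  unfolding monom_deg_def by (rule setsum_keys_plus_distrib) auto

lemma monom_deg_zero [simp]: "monom_deg 0 = 0"
  by (simp add: monom_deg_def)

lemma zero_sum_monom: "s + t = 0 \<longleftrightarrow> s = 0 \<and> t = 0" for s t :: "'v \<Rightarrow>\<^sub>0 nat"
  by (auto simp: poly_mapping_eq_iff fun_eq_iff lookup_add)

lemma mpoly_eq_sum_single: "p = (\<Sum>t\<in>keys p. single t (lookup p t))"
  by (rule poly_mapping_eqI) (simp add: lookup_sum lookup_single when_def not_in_keys_iff_lookup_eq_zero)

text \<open>For a monoid \<open>U\<close> this is its monoid algebra, and for an ideal of a monoid
  it is the corresponding monomial ideal.\<close>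

definition supported :: "('v \<Rightarrow>\<^sub>0 nat) set \<Rightarrow> ('v, 'k::comm_ring_1) mpoly set" where
  "supported U = {p. keys p \<subseteq> U}"

lemma supported_zero: "0 \<in> supported U"
  by (simp add: supported_def)

lemma supported_add: "p \<in> supported U \<Longrightarrow> q \<in> supported U \<Longrightarrow> p + q \<in> supported U"
  using keys_add[of p q] by (auto simp: supported_def)

lemma supported_uminus: "p \<in> supported U \<Longrightarrow> - p \<in> supported U"
  by (auto simp: supported_def in_keys_iff)

lemma supported_sum: "(\<And>k. k \<in> A \<Longrightarrow> f k \<in> supported U) \<Longrightarrow> sum f A \<in> supported U"
  by (induction A rule: infinite_finite_induct) (auto simp: supported_zero supported_add)

lemma supported_single: "t \<in> U \<Longrightarrow> single t c \<in> supported U"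
  by (auto simp: supported_def)

lemma supported_mult:
  assumes "p \<in> supported U" "q \<in> supported V" "\<And>s t. s \<in> U \<Longrightarrow> t \<in> V \<Longrightarrow> s + t \<in> W"
  shows "p * q \<in> supported W"
  using assms keys_mult[of p q] unfolding supported_def by fastforce

lemma supported_mono: "U \<subseteq> V \<Longrightarrow> supported U \<subseteq> supported V"
  by (auto simp: supported_def)

text \<open>Translation of exponents is injective, so multiplication by a monomial cannot cancel
  terms. Hence the colon of a monomial ideal by a monomial is again monomial.\<close>

lemma keys_mult_single_one:
  fixes p :: "('v, 'k::comm_ring_1) mpoly"
  shows "keys (p * single b 1) = (\<lambda>t. t + b) ` keys p"
proof -
  have "lookup (p * single b 1) x = (\<Sum>t\<in>keys p. lookup p t when t + b = x)" for x
  proof -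
    have "p * single b 1 = (\<Sum>t\<in>keys p. single (t + b) (lookup p t))"
      by (subst mpoly_eq_sum_single[of p]) (simp add: sum_distrib_right mult_single)
    then show ?thesis by (simp add: lookup_sum lookup_single)
  qed
  moreover have "(\<Sum>t\<in>keys p. lookup p t when t + b = s + b) = lookup p s" for s
    by (simp add: when_def not_in_keys_iff_lookup_eq_zero)
  moreover have "(\<Sum>t\<in>keys p. lookup p t when t + b = x) = 0" if "x \<notin> (\<lambda>t. t + b) ` keys p" for x
    using that by (intro sum.neutral) (auto simp: when_def)
  ultimately show ?thesis by (auto simp: in_keys_iff) metis
qed

section \<open>Homogeneous components as restrictions of the support\<close>

definition restr :: "('a \<Rightarrow> bool) \<Rightarrow> ('a \<Rightarrow>\<^sub>0 'b::zero) \<Rightarrow> ('a \<Rightarrow>\<^sub>0 'b)" where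
  "restr P p = Abs_poly_mapping (\<lambda>t. lookup p t when P t)"

lemma lookup_restr: "lookup (restr P p) t = (lookup p t when P t)"
proof -
  have "finite {t. (lookup p t when P t) \<noteq> 0}"
    by (rule finite_subset[OF _ finite_lookup[of p]]) auto
  then show ?thesis by (simp add: restr_def)
qed

lemma keys_restr: "keys (restr P p) = {t \<in> keys p. P t}"
  by (auto simp: in_keys_iff lookup_restr)

lemma restr_add:
  fixes p q :: "'a \<Rightarrow>\<^sub>0 'b::comm_monoid_add"
  shows "restr P (p + q) = restr P p + restr P q"
  by (rule poly_mapping_eqI) (simp add: lookup_restr lookup_add when_add_distrib)

lemma restr_id: "(\<And>t. t \<in> keys p \<Longrightarrow> P t) \<Longrightarrow> restr P p = p"
  by (rule poly_mapping_eqI) (auto simp: lookup_restr when_def in_keys_iff)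

lemma restr_none: "(\<And>t. t \<in> keys p \<Longrightarrow> \<not> P t) \<Longrightarrow> restr P p = 0"
  by (rule poly_mapping_eqI) (auto simp: lookup_restr when_def in_keys_iff)

lemma restr_split: "p = restr P p + restr (\<lambda>t. \<not> P t) (p :: 'a \<Rightarrow>\<^sub>0 'b::comm_monoid_add)"
  by (rule poly_mapping_eqI) (auto simp: lookup_restr lookup_add when_def)

text \<open>Every monomial of \<open>q\<close> has degree \<open>e\<close>, so only the degree
  \<open>n\<close> part of \<open>p\<close> contributes to degree \<open>n + e\<close>.\<close>

lemma restr_mult:
  fixes p q :: "('v, 'k::comm_ring_1) mpoly"
  assumes "\<And>t. t \<in> keys q \<Longrightarrow> monom_deg t = e"
  shows "restr (\<lambda>t. monom_deg t = n + e) (p * q) = restr (\<lambda>t. monom_deg t = n) p * q"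
proof -
  let ?P = "\<lambda>t. monom_deg t = n"
  let ?Q = "\<lambda>t. monom_deg t = n + e"
  have k: "\<exists>a b. t = a + b \<and> a \<in> keys p' \<and> b \<in> keys q" if "t \<in> keys (p' * q)" for t and p' :: "('v, 'k) mpoly"
    using that keys_mult[of p' q] by blast
  have "p * q = restr ?P p * q + restr (\<lambda>t. \<not> ?P t) p * q"
    using restr_split[of p ?P] by (metis distrib_right)
  moreover have "restr ?Q (restr ?P p * q) = restr ?P p * q"
    by (rule restr_id) (use assms in \<open>auto dest!: k simp: keys_restr monom_deg_add\<close>)
  moreover have "restr ?Q (restr (\<lambda>t. \<not> ?P t) p * q) = 0"
    by (rule restr_none) (use assms in \<open>auto dest!: k simp: keys_restr monom_deg_add\<close>)
  ultimately show ?thesis by (simp add: restr_add)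
qed

text \<open>All degrees are multiples of \<open>d\<close>, so the monoid algebra can be graded by
  the degree divided by \<open>d\<close>.\<close>

locale graded_monoid =
  fixes S :: "('v \<Rightarrow>\<^sub>0 nat) set" and d :: nat
  assumes zero_S: "0 \<in> S" and add_S: "s \<in> S \<Longrightarrow> t \<in> S \<Longrightarrow> s + t \<in> S"
    and d_pos: "d > 0"
    and deg_S: "s \<in> S \<Longrightarrow> d dvd monom_deg s"
begin

definition grade :: "nat \<Rightarrow> ('v \<Rightarrow>\<^sub>0 nat) set" where
  "grade n = {t \<in> S. monom_deg t = n * d}"

text \<open>The cofactor \<open>s\<close> has to lie in \<open>S\<close>: this is the ideal
  generated inside the monoid, not the set of all larger exponents.\<close>

definition upset :: "nat \<Rightarrow> (nat \<Rightarrow> ('v \<Rightarrow>\<^sub>0 nat)) \<Rightarrow> ('v \<Rightarrow>\<^sub>0 nat) set" where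
  "upset q b = {b k + s | k s. k < q \<and> s \<in> S}"

text \<open>The counterpart of \<open>koszul_family\<close> for exponents, where adding
  \<open>b k\<close> stands for multiplying by a monomial.\<close>

definition koszul_filtration :: "('v \<Rightarrow>\<^sub>0 nat) set set \<Rightarrow> bool" where
  "koszul_filtration \<U> \<longleftrightarrow> (\<forall>U\<in>\<U>. \<exists>q b. (\<forall>k<q. b k \<in> grade 1) \<and> U = upset q b \<and>
     (\<forall>k<q. {x \<in> S. x + b k \<in> upset k b} \<in> \<U>))"

lemma grade_subset: "grade n \<subseteq> S"
  by (auto simp: grade_def)

text \<open>The usual degrees \<open>d\<close> and \<open>2 * d\<close> are the degrees one and two
  of the rescaled grading.\<close>

sublocale degree_one_data "supported S :: ('v, 'k::comm_ring_1) mpoly set" "supported (grade 1)"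
  "restr (\<lambda>t. monom_deg t = d)" "restr (\<lambda>t. monom_deg t = 2 * d)"
proof
  fix a b :: "('v, 'k) mpoly"
  show "1 \<in> (supported S :: ('v, 'k) mpoly set)" using zero_S by (simp add: supported_def)
  show "a \<in> supported S \<Longrightarrow> b \<in> supported S \<Longrightarrow> a + b \<in> supported S" by (rule supported_add)
  show "a \<in> supported S \<Longrightarrow> - a \<in> supported S" by (rule supported_uminus)
  show "a \<in> supported S \<Longrightarrow> b \<in> supported S \<Longrightarrow> a * b \<in> supported S"
    by (rule supported_mult[OF _ _ add_S])
  show "supported (grade 1) \<subseteq> (supported S :: ('v, 'k) mpoly set)"
    by (rule supported_mono[OF grade_subset])
  show "a \<in> supported S \<Longrightarrow> restr (\<lambda>t. monom_deg t = d) a \<in> supported (grade 1)"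
    by (auto simp: supported_def keys_restr grade_def)
  show "a \<in> supported (grade 1) \<Longrightarrow> restr (\<lambda>t. monom_deg t = d) a = a"
    by (rule restr_id) (auto simp: supported_def grade_def)
  show "a \<in> supported S \<Longrightarrow> b \<in> supported (grade 1) \<Longrightarrow>
      restr (\<lambda>t. monom_deg t = 2 * d) (a * b) = restr (\<lambda>t. monom_deg t = d) a * b"
    using restr_mult[of b d d a] by (auto simp: supported_def grade_def mult_2)
qed (simp_all add: restr_add)

text \<open>Each monomial in the support is a generator times a cofactor in \<open>S\<close>. Fixing
  one such factorization per monomial and collecting the terms by generator produces the
  coefficients.\<close>

lemma ideal_span_single:
  assumes "\<And>k. k < q \<Longrightarrow> b k \<in> S"
  shows "ideal_span q (\<lambda>k. single (b k) 1) = (supported (upset q b) :: ('v, 'k::comm_ring_1) mpoly set)"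
proof (intro equalityI subsetI)
  fix p :: "('v, 'k) mpoly" assume "p \<in> ideal_span q (\<lambda>k. single (b k) 1)"
  then obtain c where c: "\<forall>k<q. c k \<in> supported S" "p = (\<Sum>k<q. c k * single (b k) 1)"
    unfolding ideal_span_def by blast
  have "c k * single (b k) 1 \<in> supported (upset q b)" if "k < q" for k
  proof (rule supported_mult)
    show "c k \<in> supported S" using c(1) that by blast
    show "single (b k) 1 \<in> supported {b k}" by (simp add: supported_def)
    show "s + t \<in> upset q b" if "s \<in> S" "t \<in> {b k}" for s t
      unfolding upset_def using that \<open>k < q\<close> by (auto simp: add.commute)
  qed
  then show "p \<in> supported (upset q b)" unfolding c(2) by (intro supported_sum) auto
next
  fix p :: "('v, 'k) mpoly" assume p: "p \<in> supported (upset q b)"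
  have "\<forall>t\<in>keys p. \<exists>k s. k < q \<and> s \<in> S \<and> t = b k + s"
    using p unfolding supported_def upset_def by blast
  then obtain f h where fh: "\<And>t. t \<in> keys p \<Longrightarrow> f t < q \<and> h t \<in> S \<and> t = b (f t) + h t" by metis
  define c where "c k = (\<Sum>t | t \<in> keys p \<and> f t = k. single (h t) (lookup p t))" for k
  have "c k \<in> supported S" for k
    unfolding c_def using fh by (intro supported_sum supported_single) auto
  moreover have "p = (\<Sum>k<q. c k * single (b k) 1)"
  proof -
    have "p = (\<Sum>t\<in>keys p. single t (lookup p t))" by (rule mpoly_eq_sum_single)
    also have "\<dots> = (\<Sum>t\<in>keys p. single (h t) (lookup p t) * single (b (f t)) 1)"
    proof (rule sum.cong)
      fix t assume "t \<in> keys p"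
      then have "t = h t + b (f t)" using fh by (simp add: add.commute)
      then show "single t (lookup p t) = single (h t) (lookup p t) * single (b (f t)) 1"
        unfolding mult_single by simp
    qed simp
    also have "\<dots> = (\<Sum>k<q. \<Sum>t | t \<in> keys p \<and> f t = k. single (h t) (lookup p t) * single (b (f t)) 1)"
      using fh by (intro sum.group[symmetric]) auto
    also have "\<dots> = (\<Sum>k<q. c k * single (b k) 1)"
      unfolding c_def sum_distrib_right by (intro sum.cong) auto
    finally show ?thesis .
  qed
  ultimately show "p \<in> ideal_span q (\<lambda>k. single (b k) 1)" unfolding ideal_span_def by blast
qed

text \<open>For monomial generators, spans and colons are determined by exponent sets, so a
  combinatorial filtration yields one of ideals over every coefficient ring.\<close>

lemma koszul_family_supported:
  assumes "koszul_filtration \<U>"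
  shows "koszul_family ((\<lambda>U. supported U :: ('v, 'k::comm_ring_1) mpoly set) ` \<U>)"
  unfolding koszul_family_def
proof (rule ballI, elim imageE)
  fix I :: "('v, 'k) mpoly set" and U assume I: "I = supported U" "U \<in> \<U>"
  then obtain q b where b: "\<And>k. k < q \<Longrightarrow> b k \<in> grade 1" "U = upset q b"
    "\<And>k. k < q \<Longrightarrow> {x \<in> S. x + b k \<in> upset k b} \<in> \<U>"
    using bspec[OF assms[unfolded koszul_filtration_def] I(2)] by auto
  have bS: "\<And>k. k < q \<Longrightarrow> b k \<in> S" using b(1) grade_subset by blast
  have "{a \<in> supported S. a * single (b k) 1 \<in> ideal_span k (\<lambda>k. single (b k) 1)}
      = (supported {x \<in> S. x + b k \<in> upset k b} :: ('v, 'k) mpoly set)" if "k < q" for k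
  proof -
    have "ideal_span k (\<lambda>k. single (b k) 1) = (supported (upset k b) :: ('v, 'k) mpoly set)"
      using that bS by (intro ideal_span_single) auto
    then show ?thesis by (auto simp: supported_def keys_mult_single_one)
  qed
  then show "\<exists>q b. (\<forall>k<q. b k \<in> supported (grade 1)) \<and> I = ideal_span q b \<and>
     (\<forall>k<q. {a \<in> supported S. a * b k \<in> ideal_span k b} \<in> (\<lambda>U. supported U) ` \<U>)"
    using b(1,3) I(1) ideal_span_single[of q b, OF bS] unfolding b(2)
    by (intro exI[of _ q] exI[of _ "\<lambda>k. single (b k) 1"]) (auto simp: supported_single)
qed

text \<open>The case of the ideal spanned by the monomials other than 1. It absorbs products because
  a sum of exponents is 0 only if both summands are.\<close>

lemma maximal_ideal_resolution:
  assumes "koszul_filtration \<U>" "S - {0} \<in> \<U>"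
  shows "\<exists>(r :: nat \<Rightarrow> nat) (g :: nat \<Rightarrow> nat \<Rightarrow> nat \<Rightarrow> ('v, 'k::comm_ring_1) mpoly).
    r 0 = 1 \<and> (\<forall>i. \<forall>k<r (Suc i). \<forall>j. g i k j \<in> supported (grade 1)) \<and>
    (\<forall>a. a \<in> supported (S - {0}) \<longleftrightarrow>
      (\<exists>c. (\<forall>k<r 1. c k \<in> supported S) \<and> a = (\<Sum>k<r 1. c k * g 0 k 0))) \<and>
    (\<forall>i c. (\<forall>k<r (Suc i). c k \<in> supported S) \<longrightarrow>
      ((\<forall>j<r i. (\<Sum>k<r (Suc i). c k * g i k j) = 0) \<longleftrightarrow>
       (\<exists>c'. (\<forall>l<r (Suc (Suc i)). c' l \<in> supported S) \<and>
          (\<forall>k<r (Suc i). c k = (\<Sum>l<r (Suc (Suc i)). c' l * g (Suc i) l k)))))"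
proof (rule linear_resolution_exists[OF koszul_family_supported[OF assms(1)]])
  show "supported (S - {0}) \<in> (\<lambda>U. supported U :: ('v, 'k) mpoly set) ` \<U>"
    using assms(2) by blast
  show "supported (S - {0}) \<subseteq> (supported S :: ('v, 'k) mpoly set)" by (rule supported_mono) auto
  fix a b :: "('v, 'k) mpoly"
  show "a \<in> supported S \<Longrightarrow> b \<in> supported (S - {0}) \<Longrightarrow> a * b \<in> supported (S - {0})"
    by (rule supported_mult) (auto simp: add_S zero_sum_monom)
  show "a \<in> supported (S - {0}) \<Longrightarrow> restr (\<lambda>t. monom_deg t = d) a \<in> supported (S - {0})"
    by (auto simp: supported_def keys_restr)
qed (auto simp: supported_zero supported_add)

end

section \<open>Graded algebras isomorphic to a monoid algebra\<close>

lemma cring_typeclass_ops: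
  fixes R :: "('a::comm_ring_1, 'm) ring_scheme"
  assumes ops: "mult R = (*)" "one R = 1" "zero R = 0" "add R = (+)"
    and closed: "1 \<in> carrier R" "\<And>x y. x \<in> carrier R \<Longrightarrow> y \<in> carrier R \<Longrightarrow> x + y \<in> carrier R"
      "\<And>x. x \<in> carrier R \<Longrightarrow> - x \<in> carrier R"
      "\<And>x y. x \<in> carrier R \<Longrightarrow> y \<in> carrier R \<Longrightarrow> x * y \<in> carrier R"
  shows "cring R"
proof (intro cringI abelian_groupI comm_monoidI)
  have "1 + - 1 \<in> carrier R" using closed by blast
  then show "\<zero>\<^bsub>R\<^esub> \<in> carrier R" by (simp add: ops)
  show "\<exists>y\<in>carrier R. y \<oplus>\<^bsub>R\<^esub> x = \<zero>\<^bsub>R\<^esub>" if "x \<in> carrier R" for x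
    using closed(3)[OF that] by (intro bexI[of _ "- x"]) (auto simp: ops)
qed (auto simp: ops closed algebra_simps)

lemma field_field_ring: "field (field_ring :: 'k::field ring)"
proof (rule cring.cring_fieldI)
  show "cring (field_ring :: 'k ring)"
    by (rule cring_typeclass_ops) (simp_all add: field_ring_def)
  have "\<exists>y. y * x = 1 \<and> x * y = 1" if "x \<noteq> 0" for x :: 'k
    using that by (intro exI[of _ "inverse x"]) simp
  then show "Units field_ring = carrier field_ring - {\<zero>\<^bsub>field_ring :: 'k ring\<^esub>}"
    by (auto simp: Units_def field_ring_def)
qed

text \<open>An algebra identified by \<open>\<phi>\<close> with the span of \<open>S\<close>. The
  two instances are the monomial algebra, with the identity, and the coordinate ring, with the map
  induced by substitution, so gradedness and resolution are proved only once.\<close>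

locale monomial_model = graded_monoid S d
  for S :: "('v \<Rightarrow>\<^sub>0 nat) set" and d :: nat +
  fixes A :: "('k::field, 'a) module" and gr :: "nat \<Rightarrow> 'a set" and \<phi> :: "'a \<Rightarrow> ('v, 'k) mpoly"
  assumes cring_A: "cring A"
    and bij: "bij_betw \<phi> (carrier A) (supported S)"
    and phi_add: "x \<in> carrier A \<Longrightarrow> y \<in> carrier A \<Longrightarrow> \<phi> (x \<oplus>\<^bsub>A\<^esub> y) = \<phi> x + \<phi> y"
    and phi_mult: "x \<in> carrier A \<Longrightarrow> y \<in> carrier A \<Longrightarrow> \<phi> (x \<otimes>\<^bsub>A\<^esub> y) = \<phi> x * \<phi> y"
    and phi_one: "\<phi> \<one>\<^bsub>A\<^esub> = 1"
    and smult_in: "x \<in> carrier A \<Longrightarrow> c \<odot>\<^bsub>A\<^esub> x \<in> carrier A"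
    and phi_smult: "x \<in> carrier A \<Longrightarrow> \<phi> (c \<odot>\<^bsub>A\<^esub> x) = mConst c * \<phi> x"
    and gr_subset: "gr n \<subseteq> carrier A"
    and phi_gr: "\<phi> ` gr n = supported (grade n)"
begin

interpretation A: cring A by (rule cring_A)

section \<open>Transport along the bijection with the monoid algebra\<close>

definition \<psi> where "\<psi> = inv_into (carrier A) \<phi>"

lemma phi_in: "x \<in> carrier A \<Longrightarrow> \<phi> x \<in> supported S"
  using bij by (auto simp: bij_betw_def)

lemma psi_in: "p \<in> supported S \<Longrightarrow> \<psi> p \<in> carrier A"
  using bij by (auto simp: bij_betw_def \<psi>_def inv_into_into)

lemma phi_psi: "p \<in> supported S \<Longrightarrow> \<phi> (\<psi> p) = p"
  using bij by (auto simp: bij_betw_def \<psi>_def f_inv_into_f)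

lemma psi_phi: "x \<in> carrier A \<Longrightarrow> \<psi> (\<phi> x) = x"
  using bij by (auto simp: bij_betw_def \<psi>_def)

lemma phi_eqI: "x \<in> carrier A \<Longrightarrow> y \<in> carrier A \<Longrightarrow> \<phi> x = \<phi> y \<Longrightarrow> x = y"
  by (metis psi_phi)

lemma phi_zero: "\<phi> \<zero>\<^bsub>A\<^esub> = 0"
  using phi_add[of "\<zero>\<^bsub>A\<^esub>" "\<zero>\<^bsub>A\<^esub>"] by simp

lemma phi_zero_iff: "x \<in> carrier A \<Longrightarrow> \<phi> x = 0 \<longleftrightarrow> x = \<zero>\<^bsub>A\<^esub>"
  by (metis phi_eqI phi_zero A.zero_closed)

lemma phi_uminus: "x \<in> carrier A \<Longrightarrow> \<phi> (\<ominus>\<^bsub>A\<^esub> x) = - \<phi> x"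
  using phi_add[of x "\<ominus>\<^bsub>A\<^esub> x"] by (simp add: A.r_neg phi_zero eq_neg_iff_add_eq_0 add.commute)

lemma phi_finsum: "finite I \<Longrightarrow> (\<And>i. i \<in> I \<Longrightarrow> f i \<in> carrier A) \<Longrightarrow>
    \<phi> (\<Oplus>\<^bsub>A\<^esub>i\<in>I. f i) = (\<Sum>i\<in>I. \<phi> (f i))"
  by (induction I rule: finite_induct) (auto simp: phi_zero phi_add A.finsum_insert Pi_def)

lemma gr_iff: "x \<in> gr n \<longleftrightarrow> x \<in> carrier A \<and> \<phi> x \<in> supported (grade n)"
proof
  assume x: "x \<in> carrier A \<and> \<phi> x \<in> supported (grade n)"
  then obtain y where "y \<in> gr n" "\<phi> x = \<phi> y" unfolding phi_gr[symmetric] by auto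
  then show "x \<in> gr n" using x gr_subset[of n] phi_eqI[of x y] by auto
next
  assume "x \<in> gr n"
  then show "x \<in> carrier A \<and> \<phi> x \<in> supported (grade n)"
    using gr_subset phi_gr[of n] by blast
qed

lemma supported_grade: "p \<in> supported (grade n) \<Longrightarrow> p \<in> supported S"
  using supported_mono[OF grade_subset] by blast

lemma supported_mConst: "p \<in> supported U \<Longrightarrow> mConst c * p \<in> supported U"
  unfolding mConst_def by (rule supported_mult[of _ "{0}"]) (auto simp: supported_def)

section \<open>The algebra structure and the standard grading\<close>

lemma module_A: "module field_ring A"
proof (rule moduleI)
  show "cring field_ring" using field_field_ring by (rule fieldE(1))
  show "abelian_group A" by (rule A.abelian_group_axioms)
qed (auto simp: smult_in phi_smult phi_add mConst_def field_ring_def single_add algebra_simps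
    mult_single mult.assoc[symmetric] intro!: phi_eqI)

lemma algebra_A: "algebra field_ring A"
proof (rule algebra.intro[OF module_A cring_A], unfold_locales)
qed (auto simp: smult_in phi_smult phi_mult mult.assoc intro!: phi_eqI)

lemma submodule_gr: "submodule (gr n) field_ring A"
  by (rule module.submoduleI[OF module_A])
     (auto simp: gr_iff phi_zero supported_zero phi_uminus supported_uminus phi_add supported_add
       smult_in phi_smult supported_mConst)

text \<open>The component of degree \<open>n\<close> is the preimage of the part of
  \<open>\<phi> a\<close> of degree \<open>n * d\<close>. Finitely many are nonzero as
  \<open>\<phi> a\<close> has finite support, and they exhaust it because all degrees in
  \<open>S\<close> are multiples of \<open>d\<close>.\<close>

lemma gr_decomposition:
  assumes a: "a \<in> carrier A"
  shows "\<exists>!f. (\<forall>n. f n \<in> gr n) \<and> finite {n. f n \<noteq> \<zero>\<^bsub>A\<^esub>} \<and>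
        a = (\<Oplus>\<^bsub>A\<^esub>n\<in>{n. f n \<noteq> \<zero>\<^bsub>A\<^esub>}. f n)"
proof (rule ex1I)
  let ?r = "\<lambda>n. restr (\<lambda>t. monom_deg t = n * d) (\<phi> a)"
  define f where "f n = \<psi> (?r n)" for n
  have r: "?r n \<in> supported (grade n)" for n
    using phi_in[OF a] by (auto simp: supported_def keys_restr grade_def)
  then have fgr: "f n \<in> gr n" and phif: "\<phi> (f n) = ?r n" for n
    using supported_grade[OF r] by (auto simp: gr_iff f_def psi_in phi_psi)
  have fc: "f n \<in> carrier A" for n using fgr gr_subset by blast
  let ?D = "(\<lambda>t. monom_deg t div d) ` keys (\<phi> a)"
  have fin: "{n. f n \<noteq> \<zero>\<^bsub>A\<^esub>} \<subseteq> ?D"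
  proof
    fix n assume "n \<in> {n. f n \<noteq> \<zero>\<^bsub>A\<^esub>}"
    then have "?r n \<noteq> 0" using phi_zero_iff[OF fc] phif by auto
    then obtain t where "t \<in> keys (\<phi> a)" "monom_deg t = n * d"
      using restr_none[of "\<phi> a" "\<lambda>t. monom_deg t = n * d"] by auto
    then show "n \<in> ?D" using d_pos by force
  qed
  then have fin': "finite {n. f n \<noteq> \<zero>\<^bsub>A\<^esub>}" by (rule finite_subset) simp
  have "\<phi> a = (\<Sum>n\<in>{n. f n \<noteq> \<zero>\<^bsub>A\<^esub>}. ?r n)"
  proof (rule poly_mapping_eqI)
    fix t
    show "lookup (\<phi> a) t = lookup (\<Sum>n\<in>{n. f n \<noteq> \<zero>\<^bsub>A\<^esub>}. ?r n) t"
    proof (cases "t \<in> keys (\<phi> a)")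
      case True
      let ?n = "monom_deg t div d"
      have "d dvd monom_deg t" using True phi_in[OF a] deg_S by (auto simp: supported_def)
      then have n: "monom_deg t = m * d \<longleftrightarrow> m = ?n" for m using d_pos by auto
      have l: "lookup (?r m) t = (lookup (\<phi> a) t when m = ?n)" for m
        by (simp add: lookup_restr n)
      have "lookup (?r ?n) t \<noteq> 0" using True by (simp add: l in_keys_iff)
      then have "\<phi> (f ?n) \<noteq> 0" unfolding phif by auto
      then have "?n \<in> {n. f n \<noteq> \<zero>\<^bsub>A\<^esub>}" using phi_zero by auto
      then show ?thesis unfolding lookup_sum l using fin' by (simp add: when_def)
    next
      case False
      then show ?thesis by (simp add: lookup_sum lookup_restr not_in_keys_iff_lookup_eq_zero)
    qed
  qed
  also have "\<dots> = \<phi> (\<Oplus>\<^bsub>A\<^esub>n\<in>{n. f n \<noteq> \<zero>\<^bsub>A\<^esub>}. f n)"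
    using fin' fc by (simp add: phi_finsum phif)
  finally have "a = (\<Oplus>\<^bsub>A\<^esub>n\<in>{n. f n \<noteq> \<zero>\<^bsub>A\<^esub>}. f n)"
    using a fc by (intro phi_eqI) (auto intro: A.finsum_closed)
  then show "(\<forall>n. f n \<in> gr n) \<and> finite {n. f n \<noteq> \<zero>\<^bsub>A\<^esub>} \<and>
        a = (\<Oplus>\<^bsub>A\<^esub>n\<in>{n. f n \<noteq> \<zero>\<^bsub>A\<^esub>}. f n)" using fgr fin' by blast
  fix h assume h: "(\<forall>n. h n \<in> gr n) \<and> finite {n. h n \<noteq> \<zero>\<^bsub>A\<^esub>} \<and>
        a = (\<Oplus>\<^bsub>A\<^esub>n\<in>{n. h n \<noteq> \<zero>\<^bsub>A\<^esub>}. h n)"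
  then have hc: "h n \<in> carrier A" for n using gr_subset by blast
  have hk: "keys (\<phi> (h n)) \<subseteq> grade n" for n using h by (auto simp: gr_iff supported_def)
  have ha: "\<phi> a = (\<Sum>n\<in>{n. h n \<noteq> \<zero>\<^bsub>A\<^esub>}. \<phi> (h n))"
    using h hc phi_finsum[of "{n. h n \<noteq> \<zero>\<^bsub>A\<^esub>}" h] by auto
  show "h = f"
  proof
    fix n
    have "\<phi> (h n) = ?r n"
    proof (rule poly_mapping_eqI)
      fix t
      \<comment> \<open>Uniqueness by comparing coefficients: at a \<open>t\<close> of degree
        \<open>n * d\<close> only the summand \<open>h n\<close> can contribute.\<close>
      have z: "lookup (\<phi> (h m)) t = 0" if "monom_deg t \<noteq> m * d" for m
        using hk[of m] that by (auto simp: grade_def in_keys_iff)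
      show "lookup (\<phi> (h n)) t = lookup (?r n) t"
      proof (cases "monom_deg t = n * d")
        case False
        then show ?thesis by (simp add: z lookup_restr)
      next
        case True
        have "lookup (\<phi> a) t = (\<Sum>m\<in>{n. h n \<noteq> \<zero>\<^bsub>A\<^esub>}. lookup (\<phi> (h m)) t)"
          by (simp add: ha lookup_sum)
        also have "\<dots> = (\<Sum>m\<in>{n. h n \<noteq> \<zero>\<^bsub>A\<^esub>}. if m = n then lookup (\<phi> (h n)) t else 0)"
          using True d_pos z by (intro sum.cong) auto
        also have "\<dots> = lookup (\<phi> (h n)) t" using h by (auto simp: phi_zero)
        finally show ?thesis using True by (simp add: lookup_restr)
      qed
    qed
    then show "h n = f n" using phi_eqI[OF hc fc] phif by simp
  qed
qed

lemma gr_zero: "gr 0 = (\<lambda>c. c \<odot>\<^bsub>A\<^esub> \<one>\<^bsub>A\<^esub>) ` carrier field_ring"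
proof (intro equalityI subsetI)
  fix a assume a: "a \<in> gr 0"
  have "t = 0" if "monom_deg t = 0" for t :: "'v \<Rightarrow>\<^sub>0 nat"
    using that by (intro poly_mapping_eqI) (auto simp: monom_deg_def in_keys_iff)
  then have "keys (\<phi> a) \<subseteq> {0}" using a by (auto simp: gr_iff supported_def grade_def)
  then have "\<phi> a = mConst (lookup (\<phi> a) 0)"
    unfolding mConst_def by (intro poly_mapping_eqI) (auto simp: lookup_single when_def in_keys_iff)
  then have "a = lookup (\<phi> a) 0 \<odot>\<^bsub>A\<^esub> \<one>\<^bsub>A\<^esub>"
    using a by (intro phi_eqI) (auto simp: gr_iff smult_in phi_smult phi_one)
  then show "a \<in> (\<lambda>c. c \<odot>\<^bsub>A\<^esub> \<one>\<^bsub>A\<^esub>) ` carrier field_ring"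
    by (auto simp: field_ring_def)
next
  fix a assume "a \<in> (\<lambda>c. c \<odot>\<^bsub>A\<^esub> \<one>\<^bsub>A\<^esub>) ` carrier field_ring"
  moreover have "(1 :: ('v, 'k) mpoly) \<in> supported (grade 0)"
    using zero_S by (simp add: supported_def grade_def)
  ultimately show "a \<in> gr 0"
    by (auto simp: gr_iff smult_in phi_smult phi_one supported_mConst simp del: mult_1_right)
qed

text \<open>The finitely many generators of degree one come from the filtration, which presents
  \<open>S - {0}\<close> as \<open>upset q b\<close>.\<close>

lemma standard_graded_A:
  assumes "koszul_filtration \<U>" "S - {0} \<in> \<U>"
  shows "standard_graded field_ring A gr"
proof -
  obtain q b where b: "\<And>k. k < q \<Longrightarrow> b k \<in> grade 1" "S - {0} = upset q b"
    using bspec[OF assms[unfolded koszul_filtration_def]] by auto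
  define B where "B = (\<lambda>k. \<psi> (single (b k) 1)) ` {..<q}"
  have sb: "single (b k) 1 \<in> (supported (grade 1) :: ('v, 'k) mpoly set)" if "k < q" for k
    using b(1)[OF that] by (rule supported_single)
  have B: "B \<subseteq> gr 1"
    using sb supported_grade[OF sb] by (auto simp: B_def gr_iff psi_in phi_psi)
  let ?X = "generate_ring A (gr 0 \<union> B)"
  have XA: "?X \<subseteq> carrier A" using gr_subset B by (intro A.generate_ring_incl) blast
  have single: "\<psi> (single t c) \<in> ?X" if "t \<in> S" for t c
    using that
  proof (induction "monom_deg t" arbitrary: t rule: less_induct)
    case less
    show ?case
    proof (cases "t = 0")
      case True
      have "single t c \<in> supported S" using less by (rule_tac supported_single)
      moreover have "single t c \<in> supported (grade 0)"
        using True less by (intro supported_single) (auto simp: grade_def)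
      ultimately show ?thesis by (intro generate_ring.incl) (auto simp: gr_iff psi_in phi_psi)
    next
      case False
      then have "t \<in> upset q b" using b(2) less by auto
      \<comment> \<open>Split off a generator; the cofactor has a degree smaller by
        \<open>d > 0\<close>, so the induction hypothesis covers it.\<close>
      then obtain k s where t: "k < q" "s \<in> S" "t = b k + s" by (auto simp: upset_def)
      have bS: "b k \<in> S" "monom_deg (b k) = d" using b(1)[OF t(1)] by (auto simp: grade_def)
      have sS: "single t c \<in> supported S" "single s c \<in> supported S"
        "(single (b k) 1 :: ('v, 'k) mpoly) \<in> supported S"
        using less t bS by (auto simp: supported_single)
      have "\<psi> (single s c) \<in> ?X"
        using less.hyps[OF _ t(2)] bS d_pos by (simp add: t(3) monom_deg_add)
      moreover have "\<psi> (single (b k) 1) \<in> ?X" using t(1) by (intro generate_ring.incl) (auto simp: B_def)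
      ultimately have "\<psi> (single (b k) 1) \<otimes>\<^bsub>A\<^esub> \<psi> (single s c) \<in> ?X" by (rule_tac generate_ring.eng_mult)
      moreover have "\<psi> (single (b k) 1) \<otimes>\<^bsub>A\<^esub> \<psi> (single s c) = \<psi> (single t c)"
        using sS by (intro phi_eqI) (auto simp: psi_in phi_mult phi_psi mult_single t(3))
      ultimately show ?thesis by simp
    qed
  qed
  have sums: "\<psi> (\<Sum>t\<in>I. single t (h t)) \<in> ?X" if "finite I" "I \<subseteq> S" for I and h :: "_ \<Rightarrow> 'k"
    using that
  proof (induction I rule: finite_induct)
    case empty
    have "\<psi> 0 = \<zero>\<^bsub>A\<^esub>" using psi_phi[of "\<zero>\<^bsub>A\<^esub>"] by (simp add: phi_zero)
    then show ?case using A.zero_in_generate by simp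
  next
    case (insert t I)
    have s: "single t (h t) \<in> supported S" "(\<Sum>t\<in>I. single t (h t)) \<in> supported S"
      using insert by (auto intro!: supported_sum supported_single)
    then have "\<psi> (\<Sum>t\<in>insert t I. single t (h t)) = \<psi> (single t (h t)) \<oplus>\<^bsub>A\<^esub> \<psi> (\<Sum>t\<in>I. single t (h t))"
      using insert by (intro phi_eqI) (auto simp: psi_in phi_add phi_psi supported_add)
    then show ?case using insert single by (auto intro: generate_ring.eng_add)
  qed
  have "carrier A \<subseteq> ?X"
  proof
    fix a assume a: "a \<in> carrier A"
    have "\<psi> (\<Sum>t\<in>keys (\<phi> a). single t (lookup (\<phi> a) t)) \<in> ?X"
      using phi_in[OF a] by (intro sums) (auto simp: supported_def)
    then show "a \<in> ?X" using a by (simp add: psi_phi mpoly_eq_sum_single[symmetric])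
  qed
  then have "\<exists>B. finite B \<and> B \<subseteq> gr 1 \<and> carrier A = generate_ring A (gr 0 \<union> B)"
    using XA B by (intro exI[of _ B]) (auto simp: B_def)
  moreover have "\<one>\<^bsub>A\<^esub> \<noteq> \<zero>\<^bsub>A\<^esub>" using phi_one phi_zero by auto
  moreover have "a \<otimes>\<^bsub>A\<^esub> b \<in> gr (i + j)" if "a \<in> gr i" "b \<in> gr j" for i j a b
  proof -
    have "\<phi> a * \<phi> b \<in> supported (grade (i + j))"
      by (rule supported_mult[of _ "grade i" _ "grade j"])
        (use that in \<open>auto simp: gr_iff grade_def add_S monom_deg_add distrib_right\<close>)
    then show ?thesis using that by (auto simp: gr_iff phi_mult)
  qed
  ultimately show ?thesis
    unfolding standard_graded_def
    using field_field_ring algebra_A submodule_gr gr_decomposition gr_zero by auto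
qed

text \<open>Identifies the augmentation ideal with the monomial ideal whose resolution is available.
  A nonzero exponent in \<open>S\<close> has degree \<open>n * d\<close> with
  \<open>n \<ge> 1\<close>, so its monomial lies in a component of positive degree.\<close>

lemma positive_part_iff: "a \<in> positive_part A gr \<longleftrightarrow> a \<in> carrier A \<and> \<phi> a \<in> supported (S - {0})"
proof
  assume "a \<in> positive_part A gr"
  then have "a \<in> generate (add_monoid A) (\<Union>n\<in>{1..}. gr n)" by (simp add: positive_part_def)
  then show "a \<in> carrier A \<and> \<phi> a \<in> supported (S - {0})"
  proof (induction rule: generate.induct)
    case one
    then show ?case by (simp add: phi_zero supported_zero)
  next
    case (incl h)
    then obtain n where n: "n \<ge> 1" "h \<in> gr n" by auto
    then have "grade n \<subseteq> S - {0}" using d_pos by (auto simp: grade_def)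
    then show ?case using n supported_mono by (auto simp: gr_iff)
  next
    case (inv h)
    then obtain n where n: "n \<ge> 1" "h \<in> gr n" by auto
    then have "grade n \<subseteq> S - {0}" using d_pos by (auto simp: grade_def)
    moreover have "inv\<^bsub>add_monoid A\<^esub> h = \<ominus>\<^bsub>A\<^esub> h" by (simp add: a_inv_def)
    ultimately show ?case using n supported_mono[of "grade n" "S - {0}"] by (auto simp: gr_iff phi_uminus intro!: supported_uminus)
  next
    case (eng h1 h2)
    then show ?case by (simp add: phi_add supported_add)
  qed
next
  assume a: "a \<in> carrier A \<and> \<phi> a \<in> supported (S - {0})"
  let ?X = "generate (add_monoid A) (\<Union>n\<in>{1..}. gr n)"
  have single: "\<psi> (single t c) \<in> ?X" if "t \<in> S" "t \<noteq> 0" for t c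
  proof -
    have "monom_deg t \<noteq> 0"
    proof
      assume "monom_deg t = 0"
      then have "t = 0" by (intro poly_mapping_eqI) (auto simp: monom_deg_def in_keys_iff)
      then show False using that by simp
    qed
    moreover have "d dvd monom_deg t" using that(1) by (rule deg_S)
    then obtain n where n: "monom_deg t = n * d" by (metis dvdE mult.commute)
    ultimately have "n \<ge> 1" by (cases n) auto
    moreover have "single t c \<in> supported S" "single t c \<in> supported (grade n)"
      using that n by (auto intro!: supported_single simp: grade_def)
    ultimately show ?thesis by (intro generate.incl) (auto simp: gr_iff psi_in phi_psi)
  qed
  have sums: "\<psi> (\<Sum>t\<in>I. single t (h t)) \<in> ?X" if "finite I" "I \<subseteq> S - {0}" for I and h :: "_ \<Rightarrow> 'k"
    using that
  proof (induction I rule: finite_induct)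
    case empty
    have "\<psi> 0 = \<zero>\<^bsub>A\<^esub>" using psi_phi[of "\<zero>\<^bsub>A\<^esub>"] by (simp add: phi_zero)
    then show ?case using generate.one[of "add_monoid A"] by simp
  next
    case (insert t I)
    have s: "single t (h t) \<in> supported S" "(\<Sum>t\<in>I. single t (h t)) \<in> supported S"
      using insert by (auto intro!: supported_sum supported_single)
    then have "\<psi> (\<Sum>t\<in>insert t I. single t (h t)) = \<psi> (single t (h t)) \<oplus>\<^bsub>A\<^esub> \<psi> (\<Sum>t\<in>I. single t (h t))"
      using insert by (intro phi_eqI) (auto simp: psi_in phi_add phi_psi supported_add)
    then show ?case
      using insert single generate.eng[of "\<psi> (single t (h t))" "add_monoid A" _ "\<psi> (\<Sum>t\<in>I. single t (h t))"]
      by auto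
  qed
  have "\<psi> (\<Sum>t\<in>keys (\<phi> a). single t (lookup (\<phi> a) t)) \<in> ?X"
    using a by (intro sums) (auto simp: supported_def)
  then show "a \<in> positive_part A gr"
    using a by (simp add: positive_part_def psi_phi mpoly_eq_sum_single[symmetric])
qed

lemma positive_part_ideal: "ideal (positive_part A gr) A"
proof (rule idealI)
  show "ring A" by (rule A.ring_axioms)
  show "subgroup (positive_part A gr) (add_monoid A)"
    by (rule subgroup.intro)
      (auto simp: positive_part_iff phi_add supported_add phi_zero supported_zero
        a_inv_def[symmetric] phi_uminus supported_uminus)
  fix a x assume "a \<in> positive_part A gr" "x \<in> carrier A"
  moreover have "\<phi> x * \<phi> a \<in> supported (S - {0})" if "\<phi> a \<in> supported (S - {0})" "x \<in> carrier A" for a x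
    by (rule supported_mult[OF phi_in[OF that(2)] that(1)]) (auto simp: add_S zero_sum_monom)
  ultimately show "x \<otimes>\<^bsub>A\<^esub> a \<in> positive_part A gr" "a \<otimes>\<^bsub>A\<^esub> x \<in> positive_part A gr"
    by (auto simp: positive_part_iff phi_mult mult.commute)
qed

text \<open>The matrices \<open>g\<close> consist of linear forms. With the generators of module
  number \<open>i\<close> placed in degree \<open>i\<close>, the maps they define are homogeneous,
  and entries of positive degree make the resolution minimal.\<close>

theorem koszul_A:
  assumes \<U>: "koszul_filtration \<U>" "S - {0} \<in> \<U>"
  shows "koszul field_ring A gr"
proof -
  obtain r :: "nat \<Rightarrow> nat" and g :: "nat \<Rightarrow> nat \<Rightarrow> nat \<Rightarrow> ('v, 'k) mpoly" where rg:
    "r 0 = 1 \<and> (\<forall>i. \<forall>k<r (Suc i). \<forall>j. g i k j \<in> supported (grade 1)) \<and>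
    (\<forall>a. a \<in> supported (S - {0}) \<longleftrightarrow>
      (\<exists>c. (\<forall>k<r 1. c k \<in> supported S) \<and> a = (\<Sum>k<r 1. c k * g 0 k 0))) \<and>
    (\<forall>i c. (\<forall>k<r (Suc i). c k \<in> supported S) \<longrightarrow>
      ((\<forall>j<r i. (\<Sum>k<r (Suc i). c k * g i k j) = 0) \<longleftrightarrow>
       (\<exists>c'. (\<forall>l<r (Suc (Suc i)). c' l \<in> supported S) \<and>
          (\<forall>k<r (Suc i). c k = (\<Sum>l<r (Suc (Suc i)). c' l * g (Suc i) l k)))))"
    using maximal_ideal_resolution[OF \<U>, where 'k = 'k] by (elim exE)
  then have r0: "r 0 = 1" and g: "\<And>i k j. k < r (Suc i) \<Longrightarrow> g i k j \<in> supported (grade 1)"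
    and m: "\<And>a. a \<in> supported (S - {0}) \<longleftrightarrow>
      (\<exists>c. (\<forall>k<r 1. c k \<in> supported S) \<and> a = (\<Sum>k<r 1. c k * g 0 k 0))"
    by blast+
  have ex: "(\<forall>j<r i. (\<Sum>k<r (Suc i). c k * g i k j) = 0) \<longleftrightarrow>
       (\<exists>c'. (\<forall>l<r (Suc (Suc i)). c' l \<in> supported S) \<and>
          (\<forall>k<r (Suc i). c k = (\<Sum>l<r (Suc (Suc i)). c' l * g (Suc i) l k)))"
    if "\<And>k. k < r (Suc i) \<Longrightarrow> c k \<in> supported S" for i c
    using rg that by simp
  let ?P = "positive_part A gr"
  let ?F = "\<lambda>i. free_module A (r i)"
  define s where "s i j = i" for i j :: nat
  \<comment> \<open>Module number 0 has rank 1, so the augmentation reads coordinate 0 only.\<close>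
  define \<epsilon> where "\<epsilon> v = ?P +>\<^bsub>A\<^esub> v (0::nat)" for v
  \<comment> \<open>Images are computed as polynomials \<open>D\<close> and carried back to
    \<open>A\<close> by \<open>\<delta>\<close>, which is restricted to the rank as the extensional
    carriers require.\<close>
  define D where "D i v j = (\<Sum>k<r (Suc i). \<phi> (v k) * g i k j)" for i v j
  define \<delta> where "\<delta> i v = (\<lambda>j\<in>{..<r i}. \<psi> (D i v j))" for i v
  interpret P: ideal ?P A by (rule positive_part_ideal)
  have car: "carrier (?F i) = {..<r i} \<rightarrow>\<^sub>E carrier A" for i by (simp add: free_module_def)
  \<comment> \<open>Serves minimality as well as the inclusion of the image of
    \<open>\<delta> 0\<close> in the kernel of \<open>\<epsilon>\<close>.\<close>
  have Dpos: "D i v j \<in> supported (S - {0})" if "v \<in> carrier (?F (Suc i))" for i v j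
    unfolding D_def
  proof (rule supported_sum, rule supported_mult)
    fix k assume "k \<in> {..<r (Suc i)}"
    then show "\<phi> (v k) \<in> supported S" "g i k j \<in> supported (grade 1)"
      using that g phi_in by (auto simp: car PiE_def Pi_def)
    show "x \<in> S \<Longrightarrow> y \<in> grade 1 \<Longrightarrow> x + y \<in> S - {0}" for x y
      using d_pos by (auto simp: grade_def add_S zero_sum_monom)
  qed
  have Din: "D i v j \<in> supported S" if "v \<in> carrier (?F (Suc i))" for i v j
    using Dpos[OF that] supported_mono[of "S - {0}" S] by blast
  have dcar: "\<delta> i v \<in> carrier (?F i)" if "v \<in> carrier (?F (Suc i))" for i v
    using Din[OF that] by (auto simp: car \<delta>_def psi_in)
  have phid: "\<phi> (\<delta> i v j) = D i v j" if "v \<in> carrier (?F (Suc i))" "j < r i" for i v j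
    using Din[OF that(1)] that(2) by (simp add: \<delta>_def phi_psi)
  have vec_eqI: "u = v" if "u \<in> carrier (?F i)" "v \<in> carrier (?F i)"
    "\<And>j. j < r i \<Longrightarrow> \<phi> (u j) = \<phi> (v j)" for u v i
    using that unfolding car by (intro PiE_ext[of u _ _ v]) (auto intro!: phi_eqI)
  have addF: "u \<oplus>\<^bsub>?F i\<^esub> v = (\<lambda>j\<in>{..<r i}. u j \<oplus>\<^bsub>A\<^esub> v j)" for i u v by (simp add: free_module_def)
  have smF: "a \<odot>\<^bsub>?F i\<^esub> v = (\<lambda>j\<in>{..<r i}. a \<otimes>\<^bsub>A\<^esub> v j)" for i a v by (simp add: free_module_def)
  have comp: "u j \<in> carrier A" if "u \<in> carrier (?F i)" "j < r i" for u i j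
    using that unfolding car by blast
  have addF_in: "u \<oplus>\<^bsub>?F i\<^esub> v \<in> carrier (?F i)" if "u \<in> carrier (?F i)" "v \<in> carrier (?F i)" for i u v
    using comp[OF that(1)] comp[OF that(2)] unfolding car addF by auto
  have smF_in: "a \<odot>\<^bsub>?F i\<^esub> v \<in> carrier (?F i)" if "a \<in> carrier A" "v \<in> carrier (?F i)" for i a v
    using that(1) comp[OF that(2)] unfolding car smF by auto
  have phi_addF: "\<phi> ((u \<oplus>\<^bsub>?F i\<^esub> v) j) = \<phi> (u j) + \<phi> (v j)"
    if "u \<in> carrier (?F i)" "v \<in> carrier (?F i)" "j < r i" for i u v j
    using comp[OF that(1,3)] comp[OF that(2,3)] that(3) by (simp add: addF phi_add)
  have phi_smF: "\<phi> ((a \<odot>\<^bsub>?F i\<^esub> v) j) = \<phi> a * \<phi> (v j)"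
    if "a \<in> carrier A" "v \<in> carrier (?F i)" "j < r i" for i a v j
    using comp[OF that(2,3)] that(1,3) by (simp add: smF phi_mult)
  let ?gr = "\<lambda>i. free_grading A gr (r i) (s i)"
  have grF: "v \<in> ?gr i n \<longleftrightarrow> v \<in> carrier (?F i) \<and>
      (\<forall>j<r i. \<phi> (v j) \<in> (if i \<le> n then supported (grade (n - i)) else {0}))" for v i n
  proof (cases "i \<le> n")
    case True
    then show ?thesis unfolding free_grading_def s_def car PiE_iff by (simp add: gr_iff) blast
  next
    case False
    have "x = \<zero>\<^bsub>A\<^esub> \<longleftrightarrow> x \<in> carrier A \<and> \<phi> x = 0" for x by (metis phi_zero_iff A.zero_closed)
    with False show ?thesis unfolding free_grading_def s_def car PiE_iff by simp blast
  qed
  have d_hom: "\<delta> i \<in> graded_hom A (?F (Suc i)) (?gr (Suc i)) (?F i) (?gr i)" for i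
    unfolding graded_hom_def
  proof (intro CollectI conjI ballI allI)
    show "\<delta> i \<in> carrier (?F (Suc i)) \<rightarrow> carrier (?F i)" using dcar by blast
  next
    fix u v assume uv: "u \<in> carrier (?F (Suc i))" "v \<in> carrier (?F (Suc i))"
    show "\<delta> i (u \<oplus>\<^bsub>?F (Suc i)\<^esub> v) = \<delta> i u \<oplus>\<^bsub>?F i\<^esub> \<delta> i v"
      using uv by (intro vec_eqI[of _ i])
        (auto simp: addF_in dcar phi_addF phid D_def distrib_right sum.distrib)
  next
    fix a v assume av: "a \<in> carrier A" "v \<in> carrier (?F (Suc i))"
    show "\<delta> i (a \<odot>\<^bsub>?F (Suc i)\<^esub> v) = a \<odot>\<^bsub>?F i\<^esub> \<delta> i v"
      using av by (intro vec_eqI[of _ i])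
        (auto simp: smF_in dcar phi_smF phid D_def mult.assoc sum_distrib_left)
  next
    fix n
    show "\<delta> i ` ?gr (Suc i) n \<subseteq> ?gr i n"
    proof (rule image_subsetI)
      fix v assume v: "v \<in> ?gr (Suc i) n"
      \<comment> \<open>In degree \<open>n\<close> the source has entries of degree
        \<open>n - (i + 1)\<close>, which linear forms raise to \<open>n - i\<close>; for
        \<open>n \<le> i\<close> the source component is zero.\<close>
      have "D i v j \<in> (if i \<le> n then supported (grade (n - i)) else {0})" for j
      proof (cases "Suc i \<le> n")
        case True
        have "D i v j \<in> supported (grade (n - i))"
          unfolding D_def
        proof (rule supported_sum, rule supported_mult)
          fix k assume "k \<in> {..<r (Suc i)}"
          then show "\<phi> (v k) \<in> supported (grade (n - Suc i))" "g i k j \<in> supported (grade 1)"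
            using v True g by (auto simp: grF)
          have "n - i = (n - Suc i) + 1" using True by simp
          then show "x + y \<in> grade (n - i)" if "x \<in> grade (n - Suc i)" "y \<in> grade 1" for x y
            using that by (auto simp: grade_def add_S monom_deg_add)
        qed
        then show ?thesis using True by simp
      next
        case False
        then have "D i v j = 0" using v by (simp add: D_def grF)
        then show ?thesis by (simp add: supported_zero)
      qed
      then show "\<delta> i v \<in> ?gr i n" using v phid[of v i] dcar[of v i] by (simp add: grF)
    qed
  qed
  let ?M = "residue_module A gr"
  have hom: "(+>\<^bsub>A\<^esub>) ?P \<in> ring_hom A (A Quot ?P)" by (rule P.rcos_ring_hom)
  have carM: "carrier ?M = (+>\<^bsub>A\<^esub>) ?P ` carrier A"
    by (auto simp: residue_module_def scalars_via_def FactRing_simps)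
  have v0: "v 0 \<in> carrier A" if "v \<in> carrier (?F 0)" for v using comp[OF that] r0 by simp
  have add0: "(u \<oplus>\<^bsub>?F 0\<^esub> v) 0 = u 0 \<oplus>\<^bsub>A\<^esub> v 0"
    and sm0: "(a \<odot>\<^bsub>?F 0\<^esub> v) 0 = a \<otimes>\<^bsub>A\<^esub> v 0" for a u v
    unfolding addF smF by (simp_all add: r0)
  have e_hom: "\<epsilon> \<in> graded_hom A (?F 0) (?gr 0) ?M (residue_grading A gr)"
    unfolding graded_hom_def
  proof (intro CollectI conjI ballI allI)
    show "\<epsilon> \<in> carrier (?F 0) \<rightarrow> carrier ?M" using v0 by (auto simp: carM \<epsilon>_def)
  next
    fix u v assume "u \<in> carrier (?F 0)" "v \<in> carrier (?F 0)"
    then show "\<epsilon> (u \<oplus>\<^bsub>?F 0\<^esub> v) = \<epsilon> u \<oplus>\<^bsub>?M\<^esub> \<epsilon> v"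
      using ring_hom_add[OF hom] v0 by (simp add: \<epsilon>_def add0 residue_module_def scalars_via_def)
  next
    fix a v assume "a \<in> carrier A" "v \<in> carrier (?F 0)"
    then show "\<epsilon> (a \<odot>\<^bsub>?F 0\<^esub> v) = a \<odot>\<^bsub>?M\<^esub> \<epsilon> v"
      using ring_hom_mult[OF hom] v0 by (simp add: \<epsilon>_def sm0 residue_module_def scalars_via_def)
  next
    fix n
    have "v 0 \<in> gr n" if "v \<in> ?gr 0 n" for v
    proof -
      have "(0::nat) < r 0" by (simp add: r0)
      with that show ?thesis unfolding grF using v0 by (simp add: gr_iff)
    qed
    then show "\<epsilon> ` ?gr 0 n \<subseteq> residue_grading A gr n"
      by (auto simp: \<epsilon>_def residue_grading_def)
  qed
  have e_surj: "\<epsilon> ` carrier (?F 0) = carrier ?M"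
  proof (intro equalityI subsetI)
    fix X assume "X \<in> carrier ?M"
    then obtain a where a: "a \<in> carrier A" "X = ?P +>\<^bsub>A\<^esub> a" unfolding carM by blast
    have "(\<lambda>j\<in>{..<r 0}. a) \<in> carrier (?F 0)" unfolding car using a by auto
    moreover have "\<epsilon> (\<lambda>j\<in>{..<r 0}. a) = X" by (simp add: \<epsilon>_def r0 a)
    ultimately show "X \<in> \<epsilon> ` carrier (?F 0)" by blast
  qed (use v0 in \<open>auto simp: carM \<epsilon>_def\<close>)
  have vec: "\<exists>w\<in>carrier (?F i). \<forall>j<r i. \<phi> (w j) = c j" if "\<forall>j<r i. c j \<in> supported S" for i c
    using that by (intro bexI[of _ "\<lambda>j\<in>{..<r i}. \<psi> (c j)"]) (auto simp: car psi_in phi_psi)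
  \<comment> \<open>The coset of \<open>w 0\<close> is zero exactly if \<open>w 0\<close> lies in
    the positive part, which by \<open>m\<close> consists of the combinations of the entries
    \<open>g 0 k 0\<close>.\<close>
  have ker_e: "\<delta> 0 ` carrier (?F 1) = a_kernel (?F 0) ?M \<epsilon>"
  proof (intro equalityI subsetI)
    fix w assume "w \<in> \<delta> 0 ` carrier (?F 1)"
    then obtain v where v: "v \<in> carrier (?F (Suc 0))" "w = \<delta> 0 v" by auto
    have "(0::nat) < r 0" by (simp add: r0)
    then have "w 0 \<in> ?P"
      using phid[OF v(1), of 0] Dpos[OF v(1), of 0] v0[OF dcar[OF v(1)]] unfolding v(2)
      by (simp add: positive_part_iff)
    then have "?P +>\<^bsub>A\<^esub> w 0 = ?P" by (rule P.a_rcos_const)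
    then show "w \<in> a_kernel (?F 0) ?M \<epsilon>"
      using v dcar[of v 0] by (simp add: a_kernel_def' \<epsilon>_def residue_module_def scalars_via_def FactRing_def)
  next
    fix w assume "w \<in> a_kernel (?F 0) ?M \<epsilon>"
    then have w: "w \<in> carrier (?F 0)" "?P +>\<^bsub>A\<^esub> w 0 = ?P"
      by (auto simp: a_kernel_def' \<epsilon>_def residue_module_def scalars_via_def FactRing_def)
    then have "w 0 \<in> ?P" using P.a_rcos_self[of "w 0"] v0 by metis
    then obtain c where c: "\<forall>k<r (Suc 0). c k \<in> supported S" "\<phi> (w 0) = (\<Sum>k<r (Suc 0). c k * g 0 k 0)"
      using m[of "\<phi> (w 0)"] by (auto simp: positive_part_iff)
    obtain v where v: "v \<in> carrier (?F (Suc 0))" "\<forall>k<r (Suc 0). \<phi> (v k) = c k"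
      using vec[OF c(1)] by auto
    have "w = \<delta> 0 v"
    proof (intro vec_eqI[of _ 0])
      fix j assume j: "j < r 0"
      then have "j = 0" by (simp add: r0)
      then show "\<phi> (w j) = \<phi> (\<delta> 0 v j)"
        using phid[OF v(1) j] v(2) c(2) by (simp add: D_def)
    qed (use w dcar[OF v(1)] in auto)
    then show "w \<in> \<delta> 0 ` carrier (?F 1)" using v by auto
  qed
  have zF: "\<zero>\<^bsub>?F i\<^esub> = (\<lambda>j\<in>{..<r i}. \<zero>\<^bsub>A\<^esub>)" for i by (simp add: free_module_def)
  have ker_d: "\<delta> (Suc i) ` carrier (?F (Suc (Suc i))) = a_kernel (?F (Suc i)) (?F i) (\<delta> i)" for i
  proof -
    \<comment> \<open>Kernel and image are both rewritten as conditions on polynomials, which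
      \<open>ex\<close> then identifies.\<close>
    have K: "w \<in> a_kernel (?F (Suc i)) (?F i) (\<delta> i) \<longleftrightarrow> w \<in> carrier (?F (Suc i)) \<and> (\<forall>j<r i. D i w j = 0)" for w
    proof (cases "w \<in> carrier (?F (Suc i))")
      case True
      have "\<delta> i w = \<zero>\<^bsub>?F i\<^esub> \<longleftrightarrow> (\<forall>j<r i. \<phi> (\<delta> i w j) = 0)"
      proof
        assume "\<forall>j<r i. \<phi> (\<delta> i w j) = 0"
        then show "\<delta> i w = \<zero>\<^bsub>?F i\<^esub>"
          using dcar[OF True] by (intro vec_eqI[of _ i]) (auto simp: zF phi_zero car)
      qed (auto simp: zF phi_zero)
      then show ?thesis using True phid[OF True] by (auto simp: a_kernel_def')
    qed (auto simp: a_kernel_def')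
    have I: "w \<in> \<delta> (Suc i) ` carrier (?F (Suc (Suc i))) \<longleftrightarrow> w \<in> carrier (?F (Suc i)) \<and>
       (\<exists>c'. (\<forall>l<r (Suc (Suc i)). c' l \<in> supported S) \<and>
          (\<forall>k<r (Suc i). \<phi> (w k) = (\<Sum>l<r (Suc (Suc i)). c' l * g (Suc i) l k)))" for w
    proof
      assume "w \<in> \<delta> (Suc i) ` carrier (?F (Suc (Suc i)))"
      then obtain v where v: "v \<in> carrier (?F (Suc (Suc i)))" "w = \<delta> (Suc i) v" by auto
      have "\<phi> (v l) \<in> supported S" if "l < r (Suc (Suc i))" for l
        by (rule phi_in[OF comp[OF v(1) that]])
      then show "w \<in> carrier (?F (Suc i)) \<and>
       (\<exists>c'. (\<forall>l<r (Suc (Suc i)). c' l \<in> supported S) \<and>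
          (\<forall>k<r (Suc i). \<phi> (w k) = (\<Sum>l<r (Suc (Suc i)). c' l * g (Suc i) l k)))"
        using dcar[OF v(1)] phid[OF v(1)] unfolding v(2) D_def
        by (intro conjI exI[of _ "\<lambda>l. \<phi> (v l)"]) blast+
    next
      assume w: "w \<in> carrier (?F (Suc i)) \<and>
       (\<exists>c'. (\<forall>l<r (Suc (Suc i)). c' l \<in> supported S) \<and>
          (\<forall>k<r (Suc i). \<phi> (w k) = (\<Sum>l<r (Suc (Suc i)). c' l * g (Suc i) l k)))"
      then obtain c where c: "\<forall>l<r (Suc (Suc i)). c l \<in> supported S"
        "\<forall>k<r (Suc i). \<phi> (w k) = (\<Sum>l<r (Suc (Suc i)). c l * g (Suc i) l k)" by blast
      obtain v where v: "v \<in> carrier (?F (Suc (Suc i)))" "\<forall>k<r (Suc (Suc i)). \<phi> (v k) = c k"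
        using vec[OF c(1)] by auto
      have "w = \<delta> (Suc i) v"
        using w v c by (intro vec_eqI[of _ "Suc i"]) (auto simp: dcar phid D_def)
      then show "w \<in> \<delta> (Suc i) ` carrier (?F (Suc (Suc i)))" using v by auto
    qed
    have E: "(\<forall>j<r i. D i w j = 0) \<longleftrightarrow>
       (\<exists>c'. (\<forall>l<r (Suc (Suc i)). c' l \<in> supported S) \<and>
          (\<forall>k<r (Suc i). \<phi> (w k) = (\<Sum>l<r (Suc (Suc i)). c' l * g (Suc i) l k)))"
      if "w \<in> carrier (?F (Suc i))" for w
      unfolding D_def using that by (intro ex phi_in comp)
    have "w \<in> \<delta> (Suc i) ` carrier (?F (Suc (Suc i))) \<longleftrightarrow> w \<in> a_kernel (?F (Suc i)) (?F i) (\<delta> i)" for w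
      unfolding K I using E[of w] by (rule conj_cong[OF refl, symmetric])
    then show ?thesis by blast
  qed
  have "graded_free_resolution A gr ?M (residue_grading A gr) r s \<epsilon> \<delta>"
    unfolding graded_free_resolution_def using e_hom d_hom e_surj ker_e ker_d by blast
  moreover have "minimal_resolution A gr r \<delta>"
    unfolding minimal_resolution_def
  proof (intro allI image_subsetI)
    fix i v assume v: "v \<in> carrier (?F (Suc i))"
    show "\<delta> i v \<in> {..<r i} \<rightarrow>\<^sub>E ?P"
      using dcar[OF v] phid[OF v] Dpos[OF v] unfolding car PiE_iff by (simp add: positive_part_iff)
  qed
  moreover have "linear_resolution r s" by (simp add: linear_resolution_def s_def)
  ultimately show ?thesis
    unfolding koszul_def using standard_graded_A[OF \<U>] by blast
qed

end

section \<open>A Koszul filtration for invariant monomials in three variables\<close>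

text \<open>Starting at \<open>l\<close>, raise one coordinate by 1 at a time: as long as the sum is
  below that of \<open>u\<close>, some coordinate can still grow.\<close>

lemma sum_interpolation:
  fixes l u :: "'i::finite \<Rightarrow> nat"
  assumes "\<And>i. l i \<le> u i" "sum l UNIV \<le> p" "p \<le> sum u UNIV"
  shows "\<exists>z. (\<forall>i. l i \<le> z i \<and> z i \<le> u i) \<and> sum z UNIV = p"
  using assms(2,3)
proof (induction p rule: dec_induct)
  case base
  then show ?case using assms(1) by (intro exI[of _ l]) auto
next
  case (step n)
  then obtain z where z: "\<forall>i. l i \<le> z i \<and> z i \<le> u i" "sum z UNIV = n" by auto
  have "\<exists>i. z i < u i"
  proof (rule ccontr)
    assume "\<not> (\<exists>i. z i < u i)"
    then have "sum u UNIV \<le> sum z UNIV" by (intro sum_mono) (simp add: not_less)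
    then show False using z step by simp
  qed
  then obtain i where i: "z i < u i" ..
  have "sum (z(i := Suc (z i))) UNIV = Suc (sum z UNIV)"
    by (subst (1 2) sum.remove[of UNIV i]) auto
  then show ?case using z i by (intro exI[of _ "z(i := Suc (z i))"]) (auto simp: le_SucI)
qed

section \<open>Exponents in finitely many variables\<close>

lemma monom_deg_UNIV: "monom_deg t = (\<Sum>i\<in>UNIV. lookup t i)" for t :: "'v::finite \<Rightarrow>\<^sub>0 nat"
  unfolding monom_deg_def by (rule sum.mono_neutral_left) (auto simp: in_keys_iff)

text \<open>Ensures later that distinct generators of the same degree do not divide one
  another.\<close>

lemma monom_eqI:
  fixes s t :: "'v::finite \<Rightarrow>\<^sub>0 nat"
  assumes "\<And>i. lookup s i \<le> lookup t i" "monom_deg s = monom_deg t"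
  shows "s = t"
proof (rule poly_mapping_eqI)
  fix i
  have "\<not> lookup s i < lookup t i"
  proof
    assume "lookup s i < lookup t i"
    then have "(\<Sum>i\<in>UNIV. lookup s i) < (\<Sum>i\<in>UNIV. lookup t i)"
      using assms(1) by (intro sum_strict_mono_ex1) auto
    then show False using assms(2) by (simp add: monom_deg_UNIV)
  qed
  then show "lookup s i = lookup t i" using assms(1)[of i] by simp
qed

lemma finite_monom_deg: "finite {t :: 'v::finite \<Rightarrow>\<^sub>0 nat. monom_deg t = n}"
proof (rule finite_imageD)
  have "lookup t i \<le> monom_deg t" for t :: "'v \<Rightarrow>\<^sub>0 nat" and i
    unfolding monom_deg_UNIV by (rule member_le_sum) auto
  then have "lookup ` {t :: 'v \<Rightarrow>\<^sub>0 nat. monom_deg t = n} \<subseteq> (\<Pi>\<^sub>E i\<in>UNIV. {..n})" by auto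
  then show "finite (lookup ` {t :: 'v \<Rightarrow>\<^sub>0 nat. monom_deg t = n})"
    by (rule finite_subset) (simp add: finite_PiE)
  show "inj_on lookup {t :: 'v \<Rightarrow>\<^sub>0 nat. monom_deg t = n}" by (simp add: inj_on_def poly_mapping.lookup_inject)
qed

text \<open>\<open>L\<close> stands for the exponents of the invariant monomials of all degrees.
  Cancellation holds because invariance is a lattice condition, \<open>multiples_L\<close> because
  the exponent of the group divides \<open>N\<close>, and \<open>p \<ge> 2\<close> will come from
  the group not being cyclic.\<close>

locale invariant_lattice =
  fixes L :: "(3 \<Rightarrow>\<^sub>0 nat) set" and p N :: nat
  assumes zero_L: "0 \<in> L" and add_L: "s \<in> L \<Longrightarrow> t \<in> L \<Longrightarrow> s + t \<in> L"
    and diff_L: "s \<in> L \<Longrightarrow> s + t \<in> L \<Longrightarrow> t \<in> L"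
    and multiples_L: "(\<And>i. N dvd lookup t i) \<Longrightarrow> t \<in> L"
    and p_ge_2: "p \<ge> 2" and N_pos: "N > 0"
begin

abbreviation d where "d \<equiv> p * N"

definition S where "S = {t \<in> L. d dvd monom_deg t}"

sublocale graded_monoid S d
  by unfold_locales (use p_ge_2 N_pos in \<open>auto simp: S_def zero_L add_L monom_deg_add\<close>)

lemma mem_S: "t \<in> S \<longleftrightarrow> t \<in> L \<and> d dvd monom_deg t"
  by (simp add: S_def)

section \<open>Divisibility in the invariant monoid\<close>

definition le :: "(3 \<Rightarrow>\<^sub>0 nat) \<Rightarrow> (3 \<Rightarrow>\<^sub>0 nat) \<Rightarrow> bool" where
  "le s t \<longleftrightarrow> (\<forall>i. lookup s i \<le> lookup t i)"

text \<open>Cancellation in \<open>L\<close> makes the quotient of two members of \<open>S\<close>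
  invariant, so divisibility inside \<open>S\<close> can be tested coordinatewise.\<close>

lemma divides_S: "s \<in> S \<Longrightarrow> t \<in> S \<Longrightarrow> le s t \<Longrightarrow> \<exists>u\<in>S. t = s + u"
proof (rule bexI[of _ "t - s"])
  assume st: "s \<in> S" "t \<in> S" "le s t"
  show eq: "t = s + (t - s)"
    using st(3) by (intro poly_mapping_eqI) (simp add: le_def lookup_add lookup_minus)
  then have "t - s \<in> L" using st diff_L[of s "t - s"] by (simp add: S_def)
  moreover have "monom_deg t = monom_deg s + monom_deg (t - s)" by (subst eq) (rule monom_deg_add)
  then have "d dvd monom_deg (t - s)" using st by (auto simp: S_def dvd_add_right_iff)
  ultimately show "t - s \<in> S" by (simp add: S_def)
qed

lemma upset_iff:
  assumes "\<And>k. k < q \<Longrightarrow> b k \<in> S"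
  shows "x \<in> upset q b \<longleftrightarrow> x \<in> S \<and> (\<exists>k<q. le (b k) x)"
proof
  assume "x \<in> upset q b"
  then show "x \<in> S \<and> (\<exists>k<q. le (b k) x)"
    using assms by (auto simp: upset_def le_def lookup_add add_S)
next
  assume "x \<in> S \<and> (\<exists>k<q. le (b k) x)"
  then show "x \<in> upset q b" using assms divides_S unfolding upset_def by fastforce
qed

section \<open>Corners and caps of the scaled unimodular triangle\<close>

definition corner :: "3 \<Rightarrow> (3 \<Rightarrow>\<^sub>0 nat)" where
  "corner i = single i d"

lemma le_corner: "le (corner i) t \<longleftrightarrow> d \<le> lookup t i"
  by (auto simp: le_def corner_def lookup_single when_def)

lemma corner_grade: "corner i \<in> grade 1"
proof -
  have "corner i \<in> L" by (rule multiples_L) (simp add: corner_def lookup_single when_def)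
  moreover have "monom_deg (corner i) = d" by (simp add: corner_def monom_deg_def)
  ultimately show ?thesis by (simp add: grade_def mem_S)
qed

text \<open>The points of the \<open>p\<close>-fold unimodular triangle, scaled by \<open>N\<close>,
  that are not below all three bounds \<open>N * c i\<close>; for \<open>c = 0\<close> these are all
  its points.\<close>

definition cap :: "(3 \<Rightarrow> nat) \<Rightarrow> (3 \<Rightarrow>\<^sub>0 nat) set" where
  "cap c = {t. monom_deg t = d \<and> (\<forall>i. N dvd lookup t i) \<and> (\<exists>i. N * c i \<le> lookup t i)}"

text \<open>\<open>c i \<le> p\<close> keeps the corners in the cap, and \<open>2 * p\<close> is the
  sum that the pigeonhole argument in \<open>cap_divides\<close> can afford.\<close>

definition admissible :: "(3 \<Rightarrow> nat) \<Rightarrow> bool" where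
  "admissible c \<longleftrightarrow> (\<forall>i. c i \<le> p) \<and> sum c UNIV \<le> 2 * p"

lemma cap_grade: "cap c \<subseteq> grade 1"
  using multiples_L by (auto simp: cap_def grade_def mem_S)

lemma corner_cap: "admissible c \<Longrightarrow> corner i \<in> cap c"
  using corner_grade[of i]
  by (auto simp: cap_def admissible_def grade_def corner_def lookup_single when_def)

text \<open>If no corner divides \<open>t\<close>, round its exponents down to
  \<open>N * W i\<close>. Each of the three roundings loses less than \<open>N\<close>, so the
  numbers \<open>W i + 1\<close> sum to more than \<open>2 * p\<close>. Hence some
  \<open>c i \<le> W i\<close>, and a point of the cap fits below \<open>t\<close>.\<close>

lemma cap_divides:
  assumes c: "admissible c" and t: "t \<in> grade n" "n \<ge> 2"
  shows "\<exists>y\<in>cap c. le y t"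
proof (cases "\<exists>i. d \<le> lookup t i")
  case True
  then show ?thesis using corner_cap[OF c] le_corner by blast
next
  case False
  define W where "W i = lookup t i div N" for i
  have lt: "lookup t i < d" for i using False by (simp add: not_le)
  have Wp: "W i < p" for i using lt[of i] N_pos by (simp add: W_def div_less_iff_less_mult)
  have deg: "(\<Sum>i\<in>UNIV. lookup t i) = n * d" using t by (simp add: grade_def monom_deg_UNIV)
  have "lookup t i < N * (W i + 1)" for i
    unfolding W_def using N_pos by (metis Suc_eq_plus1 dividend_less_times_div mult_Suc_right add.commute)
  then have "(\<Sum>i\<in>UNIV. lookup t i) < (\<Sum>i\<in>UNIV. N * (W i + 1))" by (intro sum_strict_mono) auto
  also have "\<dots> = N * (sum W UNIV + 3)" by (simp add: sum_distrib_left[symmetric] sum.distrib algebra_simps)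
  finally have "N * (n * p) < N * (sum W UNIV + 3)" using deg by (simp add: ac_simps)
  then have "n * p < sum W UNIV + 3" by simp
  moreover have "2 * p \<le> n * p" using t by simp
  ultimately have W: "2 * p < sum W UNIV + 3" by linarith
  have "\<exists>i. c i \<le> W i"
  proof (rule ccontr)
    assume "\<not> (\<exists>i. c i \<le> W i)"
    then have "(\<Sum>i\<in>UNIV. W i + 1) \<le> sum c UNIV" by (intro sum_mono) (simp add: not_le Suc_le_eq)
    moreover have "(\<Sum>i\<in>UNIV. W i + 1) = sum W UNIV + 3" by (subst sum.distrib) simp
    ultimately have "sum W UNIV + 3 \<le> 2 * p" using c by (simp add: admissible_def)
    then show False using W by simp
  qed
  then obtain i where i: "c i \<le> W i" ..
  \<comment> \<open>Coordinate \<open>i\<close> is kept at \<open>W i\<close> and the others fill up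
    the total to \<open>p\<close>. There is room, since \<open>W i < p\<close> and
    \<open>sum W UNIV \<ge> 2 * p - 2 \<ge> p\<close> by \<open>p \<ge> 2\<close>.\<close>
  have "\<exists>z. (\<forall>j. (if j = i then W i else 0) \<le> z j \<and> z j \<le> W j) \<and> sum z UNIV = p"
  proof (rule sum_interpolation)
    show "(\<Sum>j\<in>UNIV. if j = i then W i else 0) \<le> p" using Wp[of i] by simp
    show "p \<le> sum W UNIV" using W p_ge_2 by linarith
  qed auto
  then obtain z where z: "\<And>j. z j \<le> W j" "W i \<le> z i" "sum z UNIV = p" by (metis le_refl)
  define y where "y = Abs_poly_mapping (\<lambda>j. N * z j)"
  have y: "lookup y j = N * z j" for j by (simp add: y_def)
  have "monom_deg y = d" by (simp add: monom_deg_UNIV y sum_distrib_left[symmetric] z(3))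
  moreover have "N * c i \<le> lookup y i" using i z(2) by (simp add: y)
  ultimately have "y \<in> cap c" by (auto simp: cap_def y)
  moreover have "N * z j \<le> lookup t j" for j
    using z(1)[of j] unfolding W_def by (metis div_times_less_eq_dividend le_trans mult.commute mult_le_mono2)
  then have "le y t" by (simp add: le_def y)
  ultimately show ?thesis by blast
qed

definition big :: "(3 \<Rightarrow>\<^sub>0 nat) set \<Rightarrow> bool" where
  "big U \<longleftrightarrow> U \<subseteq> S - {0} \<and> (\<forall>x\<in>U. \<forall>s\<in>S. x + s \<in> U) \<and> (\<exists>c. admissible c \<and> cap c \<subseteq> U)"

abbreviation corners :: "(3 \<Rightarrow>\<^sub>0 nat) list" where
  "corners \<equiv> [corner 1, corner 2, corner 3]"

text \<open>The values \<open>k = 0, 1, 2\<close> give the zero ideal and the ideals of one and of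
  two corners; the ideal of all three is not listed separately.\<close>

definition filtration :: "(3 \<Rightarrow>\<^sub>0 nat) set set" where
  "filtration = {upset k (nth corners) | k. k < 3} \<union> {U. big U}"

section \<open>Colon ideals of the filtration\<close>

lemma upset_cong: "(\<And>k. k < q \<Longrightarrow> b k = b' k) \<Longrightarrow> upset q b = upset q b'"
  unfolding upset_def by force

lemma corners_nth: "k < 3 \<Longrightarrow> corners ! k = corner (of_nat (Suc k))"
  by (auto simp: less_Suc_eq numeral_3_eq_3 nth_Cons split: nat.splits)

text \<open>The corners behave like a regular sequence: adding one of them leaves the other two
  exponents unchanged, hence does not affect divisibility by an earlier corner.\<close>

lemma corner_colon:
  assumes "k < 3"
  shows "{x \<in> S. x + corners ! k \<in> upset k (nth corners)} = upset k (nth corners)"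
proof -
  define b where "b = nth corners"
  have b: "b j = corner (of_nat (Suc j))" if "j < 3" for j
    using corners_nth[OF that] by (simp add: b_def)
  have S: "b j \<in> S" if "j < 3" for j using corner_grade grade_subset b[OF that] by auto
  have up: "x \<in> upset k b \<longleftrightarrow> x \<in> S \<and> (\<exists>j<k. le (b j) x)" for x
    using assms S by (intro upset_iff) auto
  have "le (b j) (x + b k) \<longleftrightarrow> le (b j) x" if "j < k" for j x
  proof -
    have j: "b j = corner (of_nat (Suc j))" "b k = corner (of_nat (Suc k))"
      using b[of j] b[of k] that assms by auto
    \<comment> \<open>The indices 1, 2, 3 are distinct in the type \<open>3\<close>, where 3 equals
      0.\<close>
    have "(of_nat (Suc j) :: 3) \<noteq> of_nat (Suc k)"
      using that assms by (auto simp: less_Suc_eq numeral_3_eq_3)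
    then show ?thesis unfolding j le_corner by (auto simp: lookup_add corner_def lookup_single)
  qed
  then have "(\<exists>j<k. le (b j) (x + b k)) \<longleftrightarrow> (\<exists>j<k. le (b j) x)" for x by auto
  then have "{x \<in> S. x + b k \<in> upset k b} = upset k b"
    using add_S[OF _ S[OF assms]] by (auto simp: up)
  then show ?thesis by (simp add: b_def)
qed

lemma corner_upset_filtration: "k < 3 \<Longrightarrow> upset k (nth corners) \<in> filtration"
  by (auto simp: filtration_def)

text \<open>The order of the generators matters: first the corners, then the rest of the cap, then
  all other elements of degree one in \<open>U\<close>. The colons at the corners are the small
  ideals. At a later generator the colon is big, with a new bound inside the cap and with the old
  \<open>c\<close> outside it.\<close>

lemma big_generators:
  assumes U: "big U"
  shows "\<exists>q b. (\<forall>k<q. b k \<in> grade 1) \<and> U = upset q b \<and>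
     (\<forall>k<q. {x \<in> S. x + b k \<in> upset k b} \<in> filtration)"
proof -
  obtain c where c: "admissible c" "cap c \<subseteq> U" and up: "\<And>x s. x \<in> U \<Longrightarrow> s \<in> S \<Longrightarrow> x + s \<in> U"
    and US: "U \<subseteq> S" "0 \<notin> U"
    using U by (auto simp: big_def)
  have fin: "finite (grade 1)" by (rule finite_subset[OF _ finite_monom_deg[of d]]) (auto simp: grade_def)
  have dist: "distinct corners"
    using p_ge_2 N_pos by (auto simp: corner_def poly_mapping_eq_iff fun_eq_iff lookup_single when_def)
  obtain ws1 where ws1: "set ws1 = cap c - set corners" "distinct ws1"
    using finite_distinct_list[of "cap c - set corners"] fin cap_grade[of c] finite_subset by blast
  obtain ws2 where ws2: "set ws2 = U \<inter> grade 1 - cap c" "distinct ws2"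
    using finite_distinct_list[of "U \<inter> grade 1 - cap c"] fin by blast
  define ls where "ls = corners @ ws1 @ ws2"
  have cc: "set corners \<subseteq> cap c" using corner_cap[OF c(1)] by auto
  have set_cap: "set (corners @ ws1) = cap c" unfolding set_append ws1(1) using cc by blast
  have set_ls: "set ls = U \<inter> grade 1" using cc c(2) cap_grade[of c] by (auto simp: ls_def ws1 ws2)
  have distinct: "distinct ls" using dist cc ws1 ws2 by (auto simp: ls_def)
  have lsg: "ls ! k \<in> grade 1" "ls ! k \<in> U" if "k < length ls" for k
    using nth_mem[OF that] set_ls by auto
  have lsS: "ls ! k \<in> S" if "k < length ls" for k using lsg[OF that] US by auto
  have up_iff: "x \<in> upset k (nth ls) \<longleftrightarrow> x \<in> S \<and> (\<exists>j<k. le (ls ! j) x)" if "k \<le> length ls" for k x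
    using that lsS by (intro upset_iff) auto
  \<comment> \<open>Elements of degree one are listed, and from degree two on a point of the cap
    divides.\<close>
  have "U = upset (length ls) (nth ls)"
  proof (intro equalityI subsetI)
    fix x assume x: "x \<in> U"
    then have "d dvd monom_deg x" using US deg_S by auto
    then obtain n where n: "monom_deg x = n * d" by (metis dvdE mult.commute)
    have "n \<noteq> 0"
    proof
      assume "n = 0"
      then have "x = 0" using n by (intro monom_eqI[symmetric]) auto
      then show False using x US by simp
    qed
    have "\<exists>y\<in>set ls. le y x"
    proof (cases "n = 1")
      case True
      then have "x \<in> set ls" using x n US by (auto simp: set_ls grade_def)
      then show ?thesis by (auto simp: le_def)
    next
      case False
      then have "\<exists>y\<in>cap c. le y x"
        using x n US \<open>n \<noteq> 0\<close> by (intro cap_divides[OF c(1), of x n]) (auto simp: grade_def)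
      then show ?thesis using c(2) cap_grade set_ls by blast
    qed
    then show "x \<in> upset (length ls) (nth ls)" using x US by (auto simp: up_iff in_set_conv_nth)
  next
    fix x assume "x \<in> upset (length ls) (nth ls)"
    then show "x \<in> U" using up lsg(2) by (auto simp: upset_def)
  qed
  moreover have "{x \<in> S. x + ls ! k \<in> upset k (nth ls)} \<in> filtration" if k: "k < length ls" for k
  proof (cases "k < 3")
    case True
    have eq: "ls ! j = corners ! j" if "j \<le> k" for j
      using that True unfolding ls_def by (subst nth_append) auto
    have "upset k (nth ls) = upset k (nth corners)" using eq by (intro upset_cong) auto
    then have "{x \<in> S. x + ls ! k \<in> upset k (nth ls)} = upset k (nth corners)"
      using corner_colon[OF True] eq[of k] by simp
    then show ?thesis using corner_upset_filtration[OF True] by simp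
  next
    case False
    let ?b = "ls ! k"
    let ?Q = "{x \<in> S. x + ?b \<in> upset k (nth ls)}"
    have bS: "?b \<in> S" "monom_deg ?b = d" using lsS lsg k by (auto simp: grade_def)
    have Q: "x \<in> ?Q \<longleftrightarrow> x \<in> S \<and> (\<exists>j<k. le (ls ! j) (x + ?b))" for x
      using k bS by (auto simp: up_iff add_S)
    \<comment> \<open>Otherwise an earlier generator would divide \<open>?b\<close> and, having the
      same degree, equal it.\<close>
    have "0 \<notin> ?Q"
    proof
      assume "0 \<in> ?Q"
      then obtain j where j: "j < k" "le (ls ! j) ?b" unfolding Q by auto
      then have "ls ! j = ?b" using lsg[of j] k bS by (intro monom_eqI) (auto simp: le_def grade_def)
      then show False using distinct j k by (simp add: nth_eq_iff_index_eq)
    qed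
    moreover have "x + s \<in> ?Q" if "x \<in> ?Q" "s \<in> S" for x s
    proof -
      from \<open>x \<in> ?Q\<close> obtain j where "j < k" "le (ls ! j) (x + ?b)" unfolding Q by blast
      then have "le (ls ! j) (x + s + ?b)" by (auto simp: le_def lookup_add add.assoc intro: le_trans)
      then show ?thesis using that \<open>j < k\<close> unfolding Q by (auto simp: add_S)
    qed
    moreover have "\<exists>c'. admissible c' \<and> cap c' \<subseteq> ?Q"
    proof (cases "?b \<in> cap c")
      case True
      text \<open>The corners alone already put everything with \<open>x\<^sub>i + b\<^sub>i \<ge> d\<close> into the colon ideal.\<close>
      define c' where "c' i = p - lookup ?b i div N" for i
      have N: "lookup ?b i = N * (lookup ?b i div N)" for i using True by (simp add: cap_def)
      have le_p: "lookup ?b i div N \<le> p" for i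
      proof -
        have "lookup ?b i \<le> monom_deg ?b" unfolding monom_deg_UNIV by (rule member_le_sum) auto
        then have "N * (lookup ?b i div N) \<le> N * p" using bS N[of i] by (simp add: mult.commute)
        then show ?thesis using N_pos by simp
      qed
      have "N * (\<Sum>i\<in>UNIV. lookup ?b i div N) = N * p"
        using bS(2) N by (simp add: monom_deg_UNIV sum_distrib_left mult.commute)
      then have "(\<Sum>i\<in>UNIV. lookup ?b i div N) = p" using N_pos by simp
      \<comment> \<open>So the bounds \<open>c' i\<close> sum to \<open>3 * p - p = 2 * p\<close>,
        exactly the limit for admissibility.\<close>
      moreover have "sum c' UNIV + (\<Sum>i\<in>UNIV. lookup ?b i div N) = 3 * p"
        using le_p by (simp add: c'_def sum.distrib[symmetric])
      ultimately have "admissible c'" by (simp add: admissible_def c'_def)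
      moreover have "cap c' \<subseteq> ?Q"
      proof
        fix y assume y: "y \<in> cap c'"
        then obtain i where i: "N * c' i \<le> lookup y i" by (auto simp: cap_def)
        have "d = N * c' i + lookup ?b i"
          using le_p[of i] N[of i] by (metis c'_def add_mult_distrib2 le_add_diff_inverse2 mult.commute)
        then have le: "le (corner i) (y + ?b)" using i by (simp add: le_corner lookup_add)
        have "corner i \<in> set corners" using exhaust_3[of i] by auto
        then obtain j where j: "j < 3" "corners ! j = corner i"
          by (metis in_set_conv_nth length_Cons list.size(3) numeral_3_eq_3)
        then have "ls ! j = corner i" unfolding ls_def by (subst nth_append) auto
        moreover have "y \<in> S" using y cap_grade grade_subset by blast
        ultimately show "y \<in> ?Q" unfolding Q using le j(1) False by (intro conjI exI[of _ j]) auto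
      qed
      ultimately show ?thesis by blast
    next
      case nc: False
      \<comment> \<open>Outside the cap, \<open>?b\<close> belongs to the last block. All points of
        the cap precede it, and each of them divides its own product with \<open>?b\<close>.\<close>
      have kk: "length (corners @ ws1) \<le> k"
      proof (rule ccontr)
        assume "\<not> length (corners @ ws1) \<le> k"
        then have l: "k < length (corners @ ws1)" by simp
        then have "?b = (corners @ ws1) ! k"
          unfolding ls_def append_assoc[symmetric] nth_append[of "corners @ ws1"] by simp
        then have "?b \<in> set (corners @ ws1)" using nth_mem[OF l] by metis
        then show False using nc set_cap by blast
      qed
      have "cap c \<subseteq> ?Q"
      proof
        fix y assume y: "y \<in> cap c"
        then have "y \<in> set (corners @ ws1)" using set_cap by blast
        then obtain j where j: "j < length (corners @ ws1)" "(corners @ ws1) ! j = y"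
          unfolding in_set_conv_nth by blast
        then have "ls ! j = y"
          unfolding ls_def append_assoc[symmetric] nth_append[of "corners @ ws1"] by simp
        moreover have "y \<in> S" using y cap_grade grade_subset by blast
        ultimately show "y \<in> ?Q"
          unfolding Q using less_le_trans[OF j(1) kk] by (intro conjI exI[of _ j]) (auto simp: le_def lookup_add)
      qed
      then show ?thesis using c(1) by blast
    qed
    ultimately have "big ?Q" unfolding big_def by blast
    then show ?thesis by (simp add: filtration_def)
  qed
  ultimately show ?thesis using lsg by (intro exI[of _ "length ls"] exI[of _ "nth ls"]) auto
qed

lemma koszul_filtration_filtration: "koszul_filtration filtration"
  unfolding koszul_filtration_def
proof
  fix U assume "U \<in> filtration"
  then consider k where "k < 3" "U = upset k (nth corners)" | "big U" by (auto simp: filtration_def)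
  then show "\<exists>q b. (\<forall>k<q. b k \<in> grade 1) \<and> U = upset q b \<and>
     (\<forall>k<q. {x \<in> S. x + b k \<in> upset k b} \<in> filtration)"
  proof cases
    case 1
    then have "corners ! j \<in> grade 1" if "j < k" for j
      using corners_nth[of j] corner_grade that by simp
    moreover have "{x \<in> S. x + corners ! j \<in> upset j (nth corners)} \<in> filtration" if "j < k" for j
      using corner_colon[of j] corner_upset_filtration[of j] that 1 by simp
    ultimately show ?thesis using 1 by (intro exI[of _ k] exI[of _ "nth corners"]) auto
  next
    case 2
    then show ?thesis by (rule big_generators)
  qed
qed

lemma maximal_ideal_filtration: "S - {0} \<in> filtration"
proof -
  have "admissible (\<lambda>_. 0)" by (simp add: admissible_def)
  moreover have "cap (\<lambda>_. 0) \<subseteq> S - {0}"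
    using cap_grade[of "\<lambda>_. 0"] grade_subset[of 1] d_pos by (auto simp: grade_def)
  ultimately show ?thesis by (auto simp: filtration_def big_def add_S zero_sum_monom)
qed

end

section \<open>The monomial algebra and the coordinate ring\<close>

lemma a_inv_typeclass_ops:
  fixes R :: "('a::comm_ring_1, 'm) ring_scheme"
  assumes "cring R" "zero R = 0" "add R = (+)" "x \<in> carrier R" "- x \<in> carrier R"
  shows "\<ominus>\<^bsub>R\<^esub> x = - x"
proof -
  interpret cring R by fact
  show ?thesis using assms by (intro minus_equality) auto
qed

lemma supported_one: "0 \<in> U \<Longrightarrow> 1 \<in> supported U"
  by (simp add: supported_def)

lemma carrier_mpoly_ring: "carrier (mpoly_ring V) = supported {t. keys t \<subseteq> V}"
  by (auto simp: mpoly_ring_def supported_def)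

lemma mpoly_ring_ops:
  "mult (mpoly_ring V) = (*)" "one (mpoly_ring V) = 1" "zero (mpoly_ring V) = 0" "add (mpoly_ring V) = (+)"
  by (simp_all add: mpoly_ring_def)

lemma cring_mpoly_ring: "cring (mpoly_ring V :: ('v, 'k::comm_ring_1) mpoly ring)"
proof (rule cring_typeclass_ops)
  fix x y :: "('v, 'k) mpoly"
  assume "x \<in> carrier (mpoly_ring V)" "y \<in> carrier (mpoly_ring V)"
  then show "x * y \<in> carrier (mpoly_ring V)"
    unfolding carrier_mpoly_ring by (rule supported_mult) (use keys_add in fastforce)
qed (auto simp: mpoly_ring_ops carrier_mpoly_ring supported_add supported_uminus supported_one)

section \<open>Substitution as an algebra homomorphism\<close>

definition subst_monom :: "('v \<Rightarrow> ('w, 'k::comm_ring_1) mpoly) \<Rightarrow> ('v \<Rightarrow>\<^sub>0 nat) \<Rightarrow> ('w, 'k) mpoly" where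
  "subst_monom f t = (\<Prod>i\<in>keys t. f i ^ lookup t i)"

lemma subst_monom_superset:
  "finite I \<Longrightarrow> keys t \<subseteq> I \<Longrightarrow> subst_monom f t = (\<Prod>i\<in>I. f i ^ lookup t i)"
  unfolding subst_monom_def by (rule prod.mono_neutral_left) (auto simp: in_keys_iff)

lemma subst_monom_add: "subst_monom f (s + t) = subst_monom f s * subst_monom f t"
proof -
  let ?I = "keys s \<union> keys t"
  have "subst_monom f (s + t) = (\<Prod>i\<in>?I. f i ^ lookup (s + t) i)"
    using keys_add[of s t] by (intro subst_monom_superset) auto
  also have "\<dots> = (\<Prod>i\<in>?I. f i ^ lookup s i) * (\<Prod>i\<in>?I. f i ^ lookup t i)"
    by (simp add: lookup_add power_add prod.distrib)
  finally show ?thesis by (simp add: subst_monom_superset[of ?I])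
qed

lemma subst_monom_zero [simp]: "subst_monom f 0 = 1"
  by (simp add: subst_monom_def)

lemma mpoly_subst_superset:
  assumes "finite I" "keys p \<subseteq> I"
  shows "mpoly_subst f p = (\<Sum>t\<in>I. mConst (lookup p t) * subst_monom f t)"
  unfolding mpoly_subst_def subst_monom_def
  by (rule sum.mono_neutral_left) (use assms in \<open>auto simp: in_keys_iff mConst_def\<close>)

lemma mConst_add: "mConst (a + b) = mConst a + mConst b"
  by (simp add: mConst_def single_add)

lemma mConst_mult: "mConst (a * b) = mConst a * mConst b"
  by (simp add: mConst_def mult_single)

lemma mConst_one [simp]: "mConst 1 = 1"
  by (simp add: mConst_def)

lemma mpoly_subst_add: "mpoly_subst f (p + q) = mpoly_subst f p + mpoly_subst f q"
proof -
  let ?I = "keys p \<union> keys q"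
  have "mpoly_subst f (p + q) = (\<Sum>t\<in>?I. mConst (lookup (p + q) t) * subst_monom f t)"
    using keys_add[of p q] by (intro mpoly_subst_superset) auto
  then show ?thesis
    by (simp add: mpoly_subst_superset[of ?I] lookup_add mConst_add distrib_right sum.distrib)
qed

lemma mpoly_subst_zero [simp]: "mpoly_subst f 0 = 0"
  by (simp add: mpoly_subst_def)

lemma mpoly_subst_sum: "mpoly_subst f (sum g I) = (\<Sum>i\<in>I. mpoly_subst f (g i))"
  by (induction I rule: infinite_finite_induct) (auto simp: mpoly_subst_add)

lemma mpoly_subst_single: "mpoly_subst f (single t c) = mConst c * subst_monom f t"
  by (subst mpoly_subst_superset[of "{t}"]) auto

lemma mpoly_subst_mult: "mpoly_subst f (p * q) = mpoly_subst f p * mpoly_subst f q"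
proof -
  have "p * q = (\<Sum>s\<in>keys p. \<Sum>t\<in>keys q. single (s + t) (lookup p s * lookup q t))"
    by (subst mpoly_eq_sum_single[of p], subst mpoly_eq_sum_single[of q])
      (simp add: sum_product mult_single)
  then show ?thesis
    by (simp add: mpoly_subst_sum mpoly_subst_single mpoly_subst_superset[of "keys p" p]
        mpoly_subst_superset[of "keys q" q] sum_product subst_monom_add mConst_mult ac_simps)
qed

lemma mpoly_subst_one: "mpoly_subst f 1 = 1"
  using mpoly_subst_single[of f 0 1] by simp

lemma mpoly_subst_mConst: "mpoly_subst f (mConst c) = mConst c"
  using mpoly_subst_single[of f 0 c] by (simp add: mConst_def)

lemma prod_single:
  "(\<Prod>i\<in>I. single (a i) (c i)) = (single (\<Sum>i\<in>I. a i) (\<Prod>i\<in>I. c i) :: ('v, 'k::comm_ring_1) mpoly)"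
  by (induction I rule: infinite_finite_induct) (auto simp: mult_single)

text \<open>Monomials are eigenvectors of diagonal matrices, which reduces invariance to a
  multiplicative condition on the exponents.\<close>

lemma diag_act_monomial:
  fixes M :: "'k::field ^ 'n ^ 'n"
  shows "diag_act M (single t 1) = single t (\<Prod>i\<in>UNIV. M $ i $ i ^ lookup t i)"
proof -
  have pow: "(mConst c * mVar i) ^ n = (single (single i n) (c ^ n) :: ('n, 'k) mpoly)" for c i n
  proof (induction n)
    case (Suc n)
    then show ?case by (simp add: mConst_def mVar_def mult_single single_add[symmetric])
  qed simp
  have "(\<Sum>i\<in>keys t. single i (lookup t i)) = t"
    by (rule poly_mapping_eqI)
      (simp add: lookup_sum lookup_single when_def not_in_keys_iff_lookup_eq_zero)
  moreover have "(\<Prod>i\<in>keys t. M $ i $ i ^ lookup t i) = (\<Prod>i\<in>UNIV. M $ i $ i ^ lookup t i)"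
    by (rule prod.mono_neutral_left) (auto simp: in_keys_iff)
  ultimately show ?thesis
    by (simp add: diag_act_def mpoly_subst_single subst_monom_def pow prod_single)
qed

context invariant_lattice
begin

text \<open>Becomes \<open>invariant_monomials G d\<close> once \<open>L\<close> is the set of
  invariant exponents.\<close>

definition monomials :: "(3, 'k::field) mpoly set" where
  "monomials = (\<lambda>t. single t 1) ` grade 1"

text \<open>The filtration presents \<open>S - {0}\<close> as an upset of elements of degree one, so
  a factor of degree one can always be split off.\<close>

lemma grade_Suc: "x \<in> grade (Suc n) \<Longrightarrow> \<exists>b\<in>grade 1. \<exists>y\<in>grade n. x = b + y"
proof -
  assume x: "x \<in> grade (Suc n)"
  obtain q b where b: "\<And>k. k < q \<Longrightarrow> b k \<in> grade 1" "S - {0} = upset q b"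
    using bspec[OF koszul_filtration_filtration[unfolded koszul_filtration_def] maximal_ideal_filtration]
    by auto
  have "x \<in> S - {0}" using x d_pos by (auto simp: grade_def)
  then obtain k y where y: "k < q" "y \<in> S" "x = b k + y" unfolding b(2) upset_def by blast
  then have "y \<in> grade n" using b(1)[of k] x by (auto simp: grade_def monom_deg_add)
  then show ?thesis using b(1) y by blast
qed

lemma S_grade: "x \<in> S \<Longrightarrow> \<exists>n. x \<in> grade n"
proof -
  assume x: "x \<in> S"
  then have "d dvd monom_deg x" by (rule deg_S)
  then obtain n where "monom_deg x = n * d" by (metis dvdE mult.commute)
  then show ?thesis using x by (auto simp: grade_def)
qed

lemma grade_zero: "x \<in> grade 0 \<Longrightarrow> x = 0"
  by (rule monom_eqI[symmetric]) (auto simp: grade_def)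

lemma supported_grade_mult:
  "u \<in> supported (grade a) \<Longrightarrow> v \<in> supported (grade b) \<Longrightarrow> u * v \<in> supported (grade (a + b))"
  by (rule supported_mult) (auto simp: grade_def add_S monom_deg_add distrib_right)

text \<open>By \<open>grade_Suc\<close> and induction on the degree, products of the generators
  reach every monomial of \<open>S\<close>; conversely, the span of \<open>S\<close> is closed under
  the ring operations.\<close>

lemma monomial_algebra_carrier:
  "carrier (monomial_algebra monomials) = (supported S :: (3, 'k::field) mpoly set)"
proof -
  let ?R = "mpoly_ring UNIV :: (3, 'k) mpoly ring"
  let ?H = "range mConst \<union> monomials"
  interpret R: cring ?R by (rule cring_mpoly_ring)
  have car: "carrier ?R = UNIV" by (simp add: carrier_mpoly_ring supported_def)
  have "generate_ring ?R ?H \<subseteq> supported S"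
  proof
    fix p assume "p \<in> generate_ring ?R ?H"
    then show "p \<in> supported S"
    proof (induction rule: generate_ring.induct)
      case one
      then show ?case by (simp add: mpoly_ring_ops supported_one zero_S)
    next
      case (incl h)
      then show ?case using zero_S grade_subset by (auto simp: mConst_def monomials_def intro!: supported_single)
    next
      case (a_inv h)
      then show ?case
        using a_inv_typeclass_ops[of ?R h] R.is_cring by (simp add: mpoly_ring_ops car supported_uminus)
    next
      case (eng_add h1 h2)
      then show ?case by (simp add: mpoly_ring_ops supported_add)
    next
      case (eng_mult h1 h2)
      then show ?case by (simp add: mpoly_ring_ops C_mult)
    qed
  qed
  moreover have "supported S \<subseteq> generate_ring ?R ?H"
  proof
    fix p :: "(3, 'k) mpoly" assume p: "p \<in> supported S"
    have mult: "x * y \<in> generate_ring ?R ?H" if "x \<in> generate_ring ?R ?H" "y \<in> generate_ring ?R ?H" for x y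
      using generate_ring.eng_mult[OF that] by (simp add: mpoly_ring_ops)
    have add: "x + y \<in> generate_ring ?R ?H" if "x \<in> generate_ring ?R ?H" "y \<in> generate_ring ?R ?H" for x y
      using generate_ring.eng_add[OF that] by (simp add: mpoly_ring_ops)
    have single: "single x c \<in> generate_ring ?R ?H" if "x \<in> grade n" for x n c
      using that
    proof (induction n arbitrary: x)
      case 0
      then have "x = 0" by (rule grade_zero)
      then have "single x c = mConst c" by (simp add: mConst_def)
      then show ?case by (auto intro: generate_ring.incl)
    next
      case (Suc n)
      then obtain b y where by': "b \<in> grade 1" "y \<in> grade n" "x = b + y" using grade_Suc by blast
      then have "single b 1 \<in> generate_ring ?R ?H" by (auto simp: monomials_def intro!: generate_ring.incl)
      then have "single b 1 * single y c \<in> generate_ring ?R ?H" using Suc.IH by' mult by blast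
      then show ?case by (simp add: mult_single by'(3))
    qed
    have "(\<Sum>t\<in>I. single t (h t)) \<in> generate_ring ?R ?H" if "finite I" "I \<subseteq> S" for I h
      using that
    proof (induction I rule: finite_induct)
      case empty
      then show ?case using R.zero_in_generate[of ?H] by (simp add: mpoly_ring_ops)
    next
      case (insert t I)
      then show ?case using add S_grade[of t] single by auto
    qed
    then have "(\<Sum>t\<in>keys p. single t (lookup p t)) \<in> generate_ring ?R ?H"
      using p by (simp add: supported_def)
    then show "p \<in> generate_ring ?R ?H" by (simp add: mpoly_eq_sum_single[symmetric])
  qed
  ultimately show ?thesis by (simp add: monomial_algebra_def scalars_via_def)
qed

section \<open>The Koszul property of the monomial algebra\<close>

lemma monomial_algebra_ops:
  "mult (monomial_algebra B) = (*)" "one (monomial_algebra B) = 1" "zero (monomial_algebra B) = 0"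
  "add (monomial_algebra B) = (+)" "smult (monomial_algebra B) = (\<lambda>c x. mConst c * x)"
  by (simp_all add: monomial_algebra_def scalars_via_def mpoly_ring_def)

lemma monomial_grading_eq: "monomial_grading monomials d n = supported (grade n)"
  by (auto simp: monomial_grading_def monomial_algebra_carrier supported_def homogeneous_def grade_def)

lemma koszul_monomial_algebra:
  "koszul field_ring (monomial_algebra (monomials :: (3, 'k::field) mpoly set)) (monomial_grading monomials d)"
proof -
  let ?A = "monomial_algebra (monomials :: (3, 'k) mpoly set)"
  interpret monomial_model S d ?A "monomial_grading monomials d" "\<lambda>p. p"
  proof (intro monomial_model.intro monomial_model_axioms.intro)
    show "graded_monoid S d" by (rule graded_monoid_axioms)
    show "cring ?A"
      by (rule cring_typeclass_ops)
        (auto simp: monomial_algebra_ops monomial_algebra_carrier C_one C_add C_uminus C_mult)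
    show "bij_betw (\<lambda>p. p) (carrier ?A) (supported S)"
      by (simp add: monomial_algebra_carrier bij_betw_def)
    show "monomial_grading monomials d n \<subseteq> carrier ?A" for n
      by (auto simp: monomial_grading_def)
    show "c \<odot>\<^bsub>?A\<^esub> x \<in> carrier ?A" if "x \<in> carrier ?A" for c x
      using that zero_S
      by (auto simp: monomial_algebra_ops monomial_algebra_carrier mConst_def intro!: C_mult supported_single)
  qed (simp_all add: monomial_algebra_ops monomial_grading_eq)
  show ?thesis by (rule koszul_A[OF koszul_filtration_filtration maximal_ideal_filtration])
qed

lemma subst_monom_grade:
  assumes m: "m ` I \<subseteq> (monomials :: (3, 'k::field) mpoly set)" and t: "keys t \<subseteq> I"
  shows "subst_monom m t \<in> supported (grade (monom_deg t))"
proof -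
  have one: "1 \<in> (supported (grade 0) :: (3, 'k) mpoly set)"
    using zero_S by (simp add: supported_def grade_def)
  have pow: "m i ^ n \<in> supported (grade n)" if "i \<in> I" for i n
  proof (induction n)
    case (Suc n)
    have "m i \<in> supported (grade 1)" using that m by (auto simp: monomials_def supported_def)
    from supported_grade_mult[OF this Suc] show ?case by simp
  qed (simp add: one)
  have "(\<Prod>i\<in>J. m i ^ lookup t i) \<in> supported (grade (\<Sum>i\<in>J. lookup t i))" if "finite J" "J \<subseteq> I" for J
    using that
  proof (induction J rule: finite_induct)
    case (insert i J)
    then show ?case using supported_grade_mult[OF pow[of i "lookup t i"]] by simp
  qed (simp add: one)
  then show ?thesis using t by (simp add: subst_monom_def monom_deg_def)
qed

text \<open>Surjectivity in each degree: an element of \<open>grade k\<close> is a sum of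
  \<open>k\<close> elements of \<open>grade 1\<close>, hence comes from a monomial of degree
  \<open>k\<close> in the new variables.\<close>

lemma mpoly_subst_image_homogeneous:
  assumes m: "m ` {1..\<mu>} = (monomials :: (3, 'k::field) mpoly set)"
  shows "mpoly_subst m ` {p \<in> carrier (mpoly_ring {1..\<mu>}). homogeneous n p} = supported (grade n)"
    and "mpoly_subst m ` carrier (mpoly_ring {1..\<mu>}) = supported S"
proof -
  let ?T = "{t. keys t \<subseteq> {1..\<mu>}}"
  have mem: "mpoly_subst m p \<in> supported U"
    if keys: "\<And>t. t \<in> keys p \<Longrightarrow> t \<in> ?T \<and> grade (monom_deg t) \<subseteq> U" for p U
  proof -
    have "mConst c * subst_monom m t \<in> supported U" if "t \<in> keys p" for t c
    proof -
      have "subst_monom m t \<in> supported U"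
        using subst_monom_grade[of m "{1..\<mu>}" t] m keys[OF that] supported_mono by blast
      then show ?thesis
        unfolding mConst_def by (rule supported_mult[of _ "{0}", rotated]) (auto simp: supported_def)
    qed
    then show ?thesis
      by (subst mpoly_subst_superset[of "keys p"]) (auto intro: supported_sum)
  qed
  have ex: "\<exists>t. keys t \<subseteq> {1..\<mu>} \<and> monom_deg t = k \<and> subst_monom m t = single x 1"
    if "x \<in> grade k" for x k
    using that
  proof (induction k arbitrary: x)
    case 0
    then have "x = 0" by (rule grade_zero)
    then show ?case by (intro exI[of _ 0]) auto
  next
    case (Suc k)
    then obtain b y where y: "b \<in> grade 1" "y \<in> grade k" "x = b + y" using grade_Suc by blast
    from Suc.IH[OF y(2)] obtain t where t: "keys t \<subseteq> {1..\<mu>}" "monom_deg t = k" "subst_monom m t = single y 1"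
      by blast
    have "single b 1 \<in> m ` {1..\<mu>}" using y(1) by (auto simp: m monomials_def)
    then obtain i where i: "i \<in> {1..\<mu>}" "m i = single b 1" by auto
    have "subst_monom m (single i 1 + t) = single x 1"
      unfolding subst_monom_add t(3) using i by (simp add: subst_monom_def mult_single y(3))
    moreover have "keys (single i 1 + t) \<subseteq> {1..\<mu>}" using keys_add[of "single i 1" t] i t by auto
    moreover have "monom_deg (single i 1 + t) = Suc k"
      using t by (simp add: monom_deg_add) (simp add: monom_deg_def)
    ultimately show ?case by blast
  qed
  \<comment> \<open>As \<open>d > 0\<close>, the degree \<open>k\<close> is determined by
    \<open>x\<close>, so the preimage can be chosen as a function of \<open>x\<close> alone.\<close>
  have "\<exists>t. \<forall>k. x \<in> grade k \<longrightarrow> keys t \<subseteq> {1..\<mu>} \<and> monom_deg t = k \<and> subst_monom m t = single x 1" for x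
  proof (cases "\<exists>k. x \<in> grade k")
    case True
    then obtain k where k: "x \<in> grade k" ..
    then have "l = k" if "x \<in> grade l" for l using that d_pos by (auto simp: grade_def)
    then show ?thesis using ex[OF k] by blast
  qed auto
  then have "\<exists>T. \<forall>x k. x \<in> grade k \<longrightarrow>
      keys (T x) \<subseteq> {1..\<mu>} \<and> monom_deg (T x) = k \<and> subst_monom m (T x) = single x 1"
    by (intro choice allI)
  then obtain T where T: "\<And>x k. x \<in> grade k \<Longrightarrow>
      keys (T x) \<subseteq> {1..\<mu>} \<and> monom_deg (T x) = k \<and> subst_monom m (T x) = single x 1"
    by blast
  \<comment> \<open>The linear extension of \<open>T\<close>, a section of the substitution that
    respects degrees.\<close>
  define lift where "lift p = (\<Sum>x\<in>keys p. single (T x) (lookup p x))" for p :: "(3, 'k) mpoly"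
  have subst_lift: "mpoly_subst m (lift p) = p" if p: "p \<in> supported S" for p
  proof -
    have "mpoly_subst m (lift p) = (\<Sum>x\<in>keys p. mConst (lookup p x) * subst_monom m (T x))"
      by (simp add: lift_def mpoly_subst_sum mpoly_subst_single)
    also have "\<dots> = (\<Sum>x\<in>keys p. single x (lookup p x))"
    proof (rule sum.cong)
      fix x assume "x \<in> keys p"
      then obtain k where "x \<in> grade k" using p S_grade by (auto simp: supported_def)
      then show "mConst (lookup p x) * subst_monom m (T x) = single x (lookup p x)"
        using T by (simp add: mConst_def mult_single)
    qed simp
    finally show ?thesis by (simp add: mpoly_eq_sum_single[symmetric])
  qed
  show "mpoly_subst m ` {p \<in> carrier (mpoly_ring {1..\<mu>}). homogeneous n p} = supported (grade n)"
  proof (intro equalityI subsetI)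
    fix p assume "p \<in> mpoly_subst m ` {p \<in> carrier (mpoly_ring {1..\<mu>}). homogeneous n p}"
    then obtain q where "p = mpoly_subst m q" "keys q \<subseteq> ?T" "homogeneous n q"
      by (auto simp: carrier_mpoly_ring supported_def)
    then show "p \<in> supported (grade n)" by (auto simp: homogeneous_def intro!: mem)
  next
    fix p :: "(3, 'k) mpoly" assume p: "p \<in> supported (grade n)"
    have "lift p \<in> supported {t. keys t \<subseteq> {1..\<mu>} \<and> monom_deg t = n}"
      unfolding lift_def
    proof (intro supported_sum supported_single)
      fix x assume "x \<in> keys p"
      then have "x \<in> grade n" using p by (auto simp: supported_def)
      then show "T x \<in> {t. keys t \<subseteq> {1..\<mu>} \<and> monom_deg t = n}" using T by blast
    qed
    moreover have "p \<in> supported S" using p supported_mono[OF grade_subset] by blast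
    ultimately show "p \<in> mpoly_subst m ` {p \<in> carrier (mpoly_ring {1..\<mu>}). homogeneous n p}"
      by (intro image_eqI[of _ _ "lift p"]) (auto simp: subst_lift carrier_mpoly_ring supported_def homogeneous_def)
  qed
  show "mpoly_subst m ` carrier (mpoly_ring {1..\<mu>}) = supported S"
  proof (intro equalityI subsetI)
    fix p assume "p \<in> mpoly_subst m ` carrier (mpoly_ring {1..\<mu>})"
    then obtain q where "p = mpoly_subst m q" "keys q \<subseteq> ?T"
      by (auto simp: carrier_mpoly_ring supported_def)
    then show "p \<in> supported S" using grade_subset by (auto intro!: mem)
  next
    fix p :: "(3, 'k) mpoly" assume p: "p \<in> supported S"
    have "lift p \<in> supported ?T"
      unfolding lift_def
    proof (intro supported_sum supported_single)
      fix x assume "x \<in> keys p"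
      then obtain k where "x \<in> grade k" using p S_grade by (auto simp: supported_def)
      then show "T x \<in> ?T" using T by auto
    qed
    then show "p \<in> mpoly_subst m ` carrier (mpoly_ring {1..\<mu>})"
      using p by (intro image_eqI[of _ _ "lift p"]) (auto simp: subst_lift carrier_mpoly_ring)
  qed
qed

text \<open>The first isomorphism theorem, with the toric ideal as the kernel, makes the quotient an
  instance of \<open>monomial_model\<close>.\<close>

lemma coordinate_ring_iso_koszul:
  assumes m: "m ` {1..\<mu>} = (monomials :: (3, 'k::field) mpoly set)"
  shows "(\<exists>h. graded_algebra_iso field_ring (coordinate_ring \<mu> m) (coordinate_grading \<mu> m)
            (monomial_algebra monomials) (monomial_grading monomials d) h)"
    and "koszul field_ring (coordinate_ring \<mu> m) (coordinate_grading \<mu> m)"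
proof -
  let ?R = "mpoly_ring {1..\<mu>} :: (nat, 'k) mpoly ring" and ?P = "mpoly_ring UNIV :: (3, 'k) mpoly ring"
  let ?h = "mpoly_subst m" and ?I = "toric_ideal \<mu> m"
  let ?A = "coordinate_ring \<mu> m" and ?gr = "coordinate_grading \<mu> m"
  interpret R: cring ?R by (rule cring_mpoly_ring)
  interpret P: cring ?P by (rule cring_mpoly_ring)
  have "?h \<in> ring_hom ?R ?P"
    by (rule ring_hom_memI)
      (auto simp: mpoly_ring_ops mpoly_subst_add mpoly_subst_mult mpoly_subst_one carrier_mpoly_ring[of UNIV] supported_def)
  then interpret h: ring_hom_ring ?R ?P ?h
    by (intro ring_hom_ringI2 R.ring_axioms P.ring_axioms)
  have I: "?I = a_kernel ?R ?P ?h" by (simp add: toric_ideal_def)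
  interpret I: ideal ?I ?R unfolding I by (rule h.kernel_is_ideal)
  \<comment> \<open>The substitution is constant on each coset of its kernel, so the image is a
    singleton and its element is the induced value.\<close>
  define \<phi> where "\<phi> X = the_elem (?h ` X)" for X
  have phi: "\<phi> (?I +>\<^bsub>?R\<^esub> p) = ?h p" if "p \<in> carrier ?R" for p
    using h.the_elem_simp[OF that] by (simp add: \<phi>_def I)
  have ops: "carrier ?A = carrier (?R Quot ?I)" "mult ?A = mult (?R Quot ?I)" "one ?A = one (?R Quot ?I)"
    "zero ?A = zero (?R Quot ?I)" "add ?A = add (?R Quot ?I)"
    "smult ?A = (\<lambda>c x. (?I +>\<^bsub>?R\<^esub> mConst c) \<otimes>\<^bsub>?R Quot ?I\<^esub> x)"
    by (simp_all add: coordinate_ring_def scalars_via_def)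
  have hom: "\<phi> \<in> ring_hom (?R Quot ?I) ?P"
    using h.the_elem_hom unfolding \<phi>_def[abs_def] I .
  have car: "carrier ?A = (+>\<^bsub>?R\<^esub>) ?I ` carrier ?R"
    by (auto simp: ops FactRing_def A_RCOSETS_def RCOSETS_def a_r_coset_def)
  have bij: "bij_betw \<phi> (carrier ?A) (supported S)"
  proof -
    have "inj_on \<phi> (carrier ?A)"
      by (rule inj_onI) (use h.the_elem_inj in \<open>auto simp: ops I \<phi>_def\<close>)
    moreover have "\<phi> ` carrier ?A = ?h ` carrier ?R"
      unfolding car image_image using phi by (intro image_cong) auto
    ultimately show ?thesis
      unfolding bij_betw_def mpoly_subst_image_homogeneous(2)[OF m] by blast
  qed
  have mc: "mConst c \<in> carrier ?R" for c
    by (auto simp: carrier_mpoly_ring mConst_def supported_def)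
  \<comment> \<open>The quotient ring and \<open>?A\<close> share their ring fields but not their
    record type, so the axioms are unfolded and carried over.\<close>
  have cring_A: "cring ?A"
  proof -
    have "cring (?R Quot ?I)" by (rule I.quotient_is_cring[OF R.is_cring])
    moreover have "cring ?A \<longleftrightarrow> cring (?R Quot ?I)"
      unfolding cring_def ring_def abelian_group_def abelian_monoid_def abelian_group_axioms_def
        ring_axioms_def comm_monoid_def comm_monoid_axioms_def monoid_def comm_group_def group_def
        group_axioms_def Units_def by (simp add: ops)
    ultimately show ?thesis by simp
  qed
  have smult_in: "c \<odot>\<^bsub>?A\<^esub> x \<in> carrier ?A" if "x \<in> carrier ?A" for c x
  proof -
    have "?I +>\<^bsub>?R\<^esub> mConst c \<in> carrier ?A" using mc unfolding car by blast
    then show ?thesis using that monoid.m_closed[of ?A] cring_A by (simp add: ops cring_def ring_def)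
  qed
  have phi_smult: "\<phi> (c \<odot>\<^bsub>?A\<^esub> x) = mConst c * \<phi> x" if "x \<in> carrier ?A" for c x
  proof -
    have "?I +>\<^bsub>?R\<^esub> mConst c \<in> carrier (?R Quot ?I)" using mc car unfolding ops by blast
    then have "\<phi> (c \<odot>\<^bsub>?A\<^esub> x) = \<phi> (?I +>\<^bsub>?R\<^esub> mConst c) * \<phi> x"
      using ring_hom_mult[OF hom] that by (simp add: ops mpoly_ring_ops)
    then show ?thesis using phi[OF mc] by (simp add: mpoly_subst_mConst)
  qed
  have phi_gr: "\<phi> ` ?gr n = supported (grade n)" for n
  proof -
    have "\<phi> ` ?gr n = ?h ` {p \<in> carrier ?R. homogeneous n p}"
      unfolding coordinate_grading_def image_image using phi by (intro image_cong) auto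
    then show ?thesis unfolding mpoly_subst_image_homogeneous(1)[OF m] .
  qed
  interpret monomial_model S d ?A ?gr \<phi>
  proof (intro monomial_model.intro monomial_model_axioms.intro)
    show "graded_monoid S d" by (rule graded_monoid_axioms)
    show "?gr n \<subseteq> carrier ?A" for n by (auto simp: coordinate_grading_def car)
    show "\<phi> (x \<oplus>\<^bsub>?A\<^esub> y) = \<phi> x + \<phi> y" if "x \<in> carrier ?A" "y \<in> carrier ?A" for x y
      using ring_hom_add[OF hom] that by (simp add: ops mpoly_ring_ops)
    show "\<phi> (x \<otimes>\<^bsub>?A\<^esub> y) = \<phi> x * \<phi> y" if "x \<in> carrier ?A" "y \<in> carrier ?A" for x y
      using ring_hom_mult[OF hom] that by (simp add: ops mpoly_ring_ops)
    show "\<phi> \<one>\<^bsub>?A\<^esub> = 1" using ring_hom_one[OF hom] by (simp add: ops mpoly_ring_ops)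
  qed (fact cring_A bij smult_in phi_smult phi_gr)+
  show "koszul field_ring ?A ?gr"
    by (rule koszul_A[OF koszul_filtration_filtration maximal_ideal_filtration])
  have "graded_algebra_iso field_ring ?A ?gr (monomial_algebra monomials) (monomial_grading monomials d) \<phi>"
    unfolding graded_algebra_iso_def ring_iso_def ring_hom_def
    using bij phi_add phi_mult phi_one phi_smult phi_gr phi_in
    by (auto simp: monomial_algebra_carrier monomial_algebra_ops monomial_grading_eq)
  then show "\<exists>h. graded_algebra_iso field_ring ?A ?gr (monomial_algebra monomials) (monomial_grading monomials d) h"
    by blast
qed

end

section \<open>Groups of diagonal matrices\<close>

lemma group_GL: "group (GL :: ('k::field ^ 'n ^ 'n) monoid)"
proof (rule groupI)
  fix x :: "'k ^ 'n ^ 'n" assume "x \<in> carrier GL"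
  then obtain y where "x ** y = mat 1" "y ** x = mat 1" by (auto simp: GL_def invertible_def)
  then show "\<exists>y\<in>carrier GL. y \<otimes>\<^bsub>GL\<^esub> x = \<one>\<^bsub>GL\<^esub>"
    by (intro bexI[of _ y]) (auto simp: GL_def invertible_def)
next
  show "\<one>\<^bsub>GL\<^esub> \<in> carrier (GL :: ('k ^ 'n ^ 'n) monoid)"
    by (auto simp: GL_def invertible_def intro: exI[of _ "mat 1"])
qed (auto simp: GL_def invertible_mult matrix_mul_assoc)

text \<open>The diagonal matrices whose \<open>n\<close>-th power is the identity; a subgroup that
  bounds the exponent of \<open>G\<close>.\<close>

definition diag_roots :: "nat \<Rightarrow> ('k::field ^ 'n ^ 'n) set" where
  "diag_roots n = {diag_mat g | g. \<forall>i. g i ^ n = 1}"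

lemma diag_mat_mult: "diag_mat g ** diag_mat h = diag_mat (\<lambda>i. g i * h i)"
  by (auto simp: diag_mat_def matrix_matrix_mult_def vec_eq_iff if_distrib[of "\<lambda>x. x * _"] cong: if_cong)

lemma diag_mat_one: "diag_mat (\<lambda>_. 1) = mat 1"
  by (auto simp: diag_mat_def mat_def)

lemma diag_roots_subgroup:
  assumes "n > 0"
  shows "subgroup (diag_roots n :: ('k::field ^ 'n ^ 'n) set) GL"
proof -
  interpret group "GL :: ('k ^ 'n ^ 'n) monoid" by (rule group_GL)
  have inv: "diag_mat (\<lambda>i. inverse (g i)) ** diag_mat g = mat 1" "diag_mat g ** diag_mat (\<lambda>i. inverse (g i)) = mat 1"
    if "\<forall>i. g i ^ n = 1" for g :: "'n \<Rightarrow> 'k"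
  proof -
    have "g i \<noteq> 0" for i using that assms by (metis power_0_left zero_neq_one neq0_conv)
    then show "diag_mat (\<lambda>i. inverse (g i)) ** diag_mat g = mat 1" "diag_mat g ** diag_mat (\<lambda>i. inverse (g i)) = mat 1"
      by (simp_all add: diag_mat_mult diag_mat_one)
  qed
  have sub: "diag_roots n \<subseteq> carrier (GL :: ('k ^ 'n ^ 'n) monoid)"
    using inv by (auto simp: diag_roots_def GL_def invertible_def)
  show ?thesis
  proof (rule subgroupI[OF sub])
    show "(diag_roots n :: ('k ^ 'n ^ 'n) set) \<noteq> {}" by (auto simp: diag_roots_def intro!: exI[of _ "\<lambda>_. 1"])
  next
    fix a :: "'k ^ 'n ^ 'n" assume a: "a \<in> diag_roots n"
    then obtain g where g: "a = diag_mat g" "\<forall>i. g i ^ n = 1" by (auto simp: diag_roots_def)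
    have b: "diag_mat (\<lambda>i. inverse (g i)) \<in> diag_roots n"
      using g(2) by (auto simp: diag_roots_def power_inverse intro!: exI[of _ "\<lambda>i. inverse (g i)"])
    have "inv\<^bsub>GL\<^esub> a = diag_mat (\<lambda>i. inverse (g i))"
      using inv[OF g(2)] a b sub by (intro inv_equality) (auto simp: GL_def g(1))
    then show "inv\<^bsub>GL\<^esub> a \<in> diag_roots n" using b by simp
  next
    fix a b :: "'k ^ 'n ^ 'n" assume "a \<in> diag_roots n" "b \<in> diag_roots n"
    then obtain g h where "a = diag_mat g" "\<forall>i. g i ^ n = 1" "b = diag_mat h" "\<forall>i. h i ^ n = 1"
      by (auto simp: diag_roots_def)
    then show "a \<otimes>\<^bsub>GL\<^esub> b \<in> diag_roots n"
      by (auto simp: diag_roots_def GL_def diag_mat_mult power_mult_distrib intro!: exI[of _ "\<lambda>i. g i * h i"])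
  qed
qed

theorem proposition4p7:
  fixes G :: "('k :: {alg_closed_field, field_char_0} ^ 3 ^ 3) set"
    and \<Gamma> :: "nat \<Rightarrow> ('k ^ 3 ^ 3) set"
    and s d \<mu> :: nat
    and ds :: "nat \<Rightarrow> nat"
    and e :: "nat \<Rightarrow> 'k"
    and \<alpha> :: "nat \<Rightarrow> 3 \<Rightarrow> nat"
    and m :: "nat \<Rightarrow> (3, 'k) mpoly"
  assumes "\<And>i. i \<in> {1..s} \<Longrightarrow> primitive_root_of_unity (ds i) (e i)"
    and "\<And>i. i \<in> {1..s} \<Longrightarrow> Gcd {\<alpha> i 0, \<alpha> i 1, \<alpha> i 2, ds i} = 1"
    and "\<And>i. i \<in> {1..s} \<Longrightarrow> \<Gamma> i = generate GL {diag_mat (\<lambda>j. e i ^ \<alpha> i j)}"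
    and "\<And>i. i \<in> {1..s} \<Longrightarrow> card (\<Gamma> i) = ds i"
    and "\<And>i. i \<in> {1..<s} \<Longrightarrow> ds i dvd ds (Suc i)"
    and "internal_direct_sum GL {1..s} \<Gamma> G"
    and "d = (\<Prod>i\<in>{1..s}. ds i)"
    and "finite G" and "card G = d"
    and "\<not> cyclic_group (GL\<lparr>carrier := G\<rparr>)"
    and "bij_betw m {1..\<mu>} (invariant_monomials G d)"
  shows "(\<exists>h. graded_algebra_iso field_ring
            (coordinate_ring \<mu> m) (coordinate_grading \<mu> m)
            (monomial_algebra (invariant_monomials G d))
            (monomial_grading (invariant_monomials G d) d) h) \<and>
         koszul field_ring (coordinate_ring \<mu> m) (coordinate_grading \<mu> m) \<and>
         koszul field_ring
            (monomial_algebra (invariant_monomials G d))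
            (monomial_grading (invariant_monomials G d) d)"
proof -
  interpret GL: group "GL :: ('k ^ 3 ^ 3) monoid" by (rule group_GL)
  let ?gen = "\<lambda>i. diag_mat (\<lambda>j. e i ^ \<alpha> i j) :: 'k ^ 3 ^ 3"
  have G: "G = generate GL (\<Union>i\<in>{1..s}. \<Gamma> i)" using assms(6) by (simp add: internal_direct_sum_def)
  have pos: "ds i > 0" and root: "e i ^ ds i = 1" if "i \<in> {1..s}" for i
    using assms(1)[OF that] by (auto simp: primitive_root_of_unity_def)
  have not_gen: "G \<noteq> generate GL {x}" if "x \<in> carrier GL" for x
    using GL.cyclic_group_generated[of x] that assms(10)
    by (auto simp: subgroup_generated_def)
  \<comment> \<open>An empty direct sum is trivial, hence cyclic.\<close>
  have "s > 0"
  proof (rule ccontr)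
    assume "\<not> s > 0"
    then have "G = generate GL {\<one>\<^bsub>GL\<^esub>}" by (simp add: G GL.generate_empty GL.generate_one)
    then show False using not_gen[of "\<one>\<^bsub>GL\<^esub>"] by simp
  qed
  \<comment> \<open>By the chain of divisors, the last order is a multiple of all the others;
    \<open>p\<close> collects their product.\<close>
  define N where "N = ds s"
  define p where "p = (\<Prod>i\<in>{1..<s}. ds i)"
  have N: "N > 0" using pos[of s] \<open>s > 0\<close> by (simp add: N_def)
  have "{1..s} = insert s {1..<s}" using \<open>s > 0\<close> by auto
  then have d: "d = p * N" by (simp add: assms(7) p_def N_def)
  have dvd_N: "ds i dvd N" if "i \<in> {1..s}" for i
  proof -
    have "i \<le> s" using that by simp
    then have "1 \<le> i \<longrightarrow> ds i dvd ds s"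
      by (induction rule: inc_induct) (use assms(5) in \<open>auto intro: dvd_trans\<close>)
    then show ?thesis using that by (simp add: N_def)
  qed
  have gen_roots: "?gen i \<in> diag_roots N" if i: "i \<in> {1..s}" for i
  proof -
    obtain k where k: "N = ds i * k" using dvd_N[OF i] by blast
    have "(e i ^ \<alpha> i j) ^ N = 1" for j
      by (simp add: k power_mult[symmetric] mult.commute[of "\<alpha> i j"] mult.assoc) (simp add: power_mult root[OF i])
    then show ?thesis unfolding diag_roots_def by blast
  qed
  have gen_in: "?gen i \<in> carrier GL" if "i \<in> {1..s}" for i
    using gen_roots[OF that] subgroup.subset[OF diag_roots_subgroup[OF N]] by blast
  have "G \<subseteq> diag_roots N"
    unfolding G
  proof (rule GL.generate_subgroup_incl[OF _ diag_roots_subgroup[OF N]], rule UN_least)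
    fix i assume "i \<in> {1..s}"
    then show "\<Gamma> i \<subseteq> diag_roots N"
      using gen_roots assms(3) GL.generate_subgroup_incl[OF _ diag_roots_subgroup[OF N]] by auto
  qed
  then have GN: "M $ i $ i ^ N = 1" if "M \<in> G" for M i
    using that by (auto simp: diag_roots_def diag_mat_def)
  \<comment> \<open>If the other orders multiply to 1, all summands except the last are trivial, and
    \<open>G\<close> is the cyclic group \<open>\<Gamma> s\<close>.\<close>
  have "p \<noteq> 1"
  proof
    assume "p = 1"
    then have one: "ds i = 1" if "i \<in> {1..<s}" for i
      using dvd_prodI[of "{1..<s}" i ds] that by (simp add: p_def)
    have sub_s: "\<Gamma> i \<subseteq> \<Gamma> s" if i: "i \<in> {1..s}" for i
    proof (cases "i = s")
      case False
      then have "ds i = 1" using one i by auto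
      then have "?gen i = mat 1" using root[OF i] by (simp add: diag_mat_one)
      then have "\<Gamma> i = {\<one>\<^bsub>GL\<^esub>}" using assms(3)[OF i] GL.generate_one by (simp add: GL_def)
      then show ?thesis using assms(3)[of s] \<open>s > 0\<close> by (simp add: generate.one)
    qed simp
    have sub: "subgroup (\<Gamma> s) GL"
      using assms(3)[of s] gen_in[of s] \<open>s > 0\<close> by (simp add: GL.generate_is_subgroup)
    have "G \<subseteq> \<Gamma> s"
      unfolding G using sub_s by (intro GL.generate_subgroup_incl[OF _ sub] UN_least) blast
    moreover have "\<Gamma> s \<subseteq> G" 
    proof
      fix x assume "x \<in> \<Gamma> s"
      then show "x \<in> G" unfolding G using \<open>s > 0\<close> by (intro generate.incl UN_I[of s]) auto
    qed
    ultimately show False using not_gen[OF gen_in[of s]] assms(3)[of s] \<open>s > 0\<close> by auto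
  qed
  moreover have "p \<noteq> 0" using pos by (auto simp: p_def)
  ultimately have p2: "p \<ge> 2" by linarith
  \<comment> \<open>Each matrix gives a character on exponents. Being multiplicative, the characters
    make their common kernel closed under sums and under cancellation.\<close>
  define L where "L = {t :: 3 \<Rightarrow>\<^sub>0 nat. \<forall>M\<in>G. (\<Prod>i\<in>UNIV. M $ i $ i ^ lookup t i) = 1}"
  have L_add: "(\<Prod>i\<in>UNIV. M $ i $ i ^ lookup (s + t) i)
      = (\<Prod>i\<in>UNIV. M $ i $ i ^ lookup s i) * (\<Prod>i\<in>UNIV. M $ i $ i ^ lookup t i)"
    for M :: "'k ^ 3 ^ 3" and s t :: "3 \<Rightarrow>\<^sub>0 nat"
    by (simp add: lookup_add power_add prod.distrib)
  interpret invariant_lattice L p N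
  proof
    fix t :: "3 \<Rightarrow>\<^sub>0 nat" assume t: "\<And>i. N dvd lookup t i"
    have "M $ i $ i ^ lookup t i = 1" if "M \<in> G" for M i
    proof -
      obtain k where "lookup t i = N * k" using t by blast
      then show ?thesis using GN[OF that] by (simp add: power_mult)
    qed
    then show "t \<in> L" by (simp add: L_def)
  qed (use p2 N in \<open>auto simp: L_def L_add\<close>)
  have "invariant_monomials G d = monomials"
  proof -
    have "single t 1 \<in> invariant_monomials G d \<longleftrightarrow> t \<in> L \<and> monom_deg t = d" for t
    proof -
      have "single t c = (single t 1 :: (3, 'k) mpoly) \<longleftrightarrow> c = 1" for c
        by (metis lookup_single_eq)
      then show ?thesis by (auto simp: invariant_monomials_def L_def diag_act_monomial dest: arg_cong[of _ _ keys])
    qed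
    moreover have "t \<in> grade 1 \<longleftrightarrow> t \<in> L \<and> monom_deg t = d" for t
      by (auto simp: grade_def mem_S d)
    ultimately show ?thesis
      by (auto simp: monomials_def) (auto simp: invariant_monomials_def)
  qed
  moreover have "m ` {1..\<mu>} = invariant_monomials G d" using assms(11) by (simp add: bij_betw_def)
  ultimately show ?thesis
    using coordinate_ring_iso_koszul[of m \<mu>] koszul_monomial_algebra d by simp
qed

end
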